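(* $\mathrm P\colon\mathcal X_n\to\mathcal P$ is a well-defined functor (in particular $\mathrm P(\mathbb X)$ is a Priestley space and $\mathrm P(\varphi)$ is a continuous order-preserving map for every object $\mathbb X$ and morphism $\varphi$ of $\mathcal X_n$). Moreover, for every $\mathbf A\in\mathcal V_n$, letting $\mathbf A^\flat=\langle A;\wedge,\vee,\mathbf f_0,\mathbf t_0\rangle$ be its bounded-distributive-lattice reduct, the Priestley space $\mathrm H(\mathbf A^\flat)$ is isomorphic to $\mathrm P(\mathrm D(\mathbf A))$.
   Context: Fix an integer $n\ge 1$; $[m,p]=\{i\in\mathbb Z:m\le i\le p\}$. Algebras have signature $(\otimes,\oplus,\wedge,\vee,\neg,\top,\mathbf f_0,\dots,\mathbf f_n,\mathbf t_0,\dots,\mathbf t_n,\bot)$. The algebra $\mathbf M_0$ has universe $\{\top^0,\mathbf f^0,\mathbf t^0,\bot^0\}$; its knowledge order has $\bot^0<\mathbf f^0<\top^0$, $\bot^0<\mathbf t^0<\top^0$ ($\mathbf f^0,\mathbf t^0$ incomparable) and its truth order has $\mathbf f^0<\top^0<\mathbf t^0$, $\mathbf f^0<\bot^0<\mathbf t^0$ ($\top^0,\bot^0$ incomparable); $\otimes,\oplus$ are meet and join in the knowledge order, $\wedge,\vee$ meet and join in the truth order; $\neg$ swaps $\mathbf f^0,\mathbf t^0$ and fixes $\top^0,\bot^0$; $\top,\bot$ denote $\top^0,\bot^0$, every $\mathbf f_i$ denotes $\mathbf f^0$ and every $\mathbf t_i$ denotes $\mathbf t^0$. For $k\in[1,n]$,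 $\mathbf M_k$ has universe $\{\top^k,\bot^k,\mathbf f^k,\mathbf t^k,\mathbf 0^k,\mathbf 1^k\}$, knowledge order generated by $\bot^k<\mathbf f^k<\mathbf 0^k<\top^k$ and $\bot^k<\mathbf t^k<\mathbf 1^k<\top^k$, truth order generated by $\mathbf 0^k<\mathbf f^k<\top^k<\mathbf t^k<\mathbf 1^k$ and $\mathbf f^k<\bot^k<\mathbf t^k$ ($\top^k,\bot^k$ incomparable), $\otimes,\oplus,\wedge,\vee$ as before, $\neg$ swapping $\mathbf f^k\leftrightarrow\mathbf t^k$, $\mathbf 0^k\leftrightarrow\mathbf 1^k$ and fixing $\top^k,\bot^k$; $\top,\bot$ denote $\top^k,\bot^k$, $\mathbf f_i$ denotes $\mathbf 0^k$ for $i<k$ and $\mathbf f^k$ for $i\ge k$, $\mathbf t_i$ denotes $\mathbf 1^k$ for $i<k$ and $\mathbf t^k$ for $i\ge k$. $\mathcal V_n$ is the class of algebras isomorphic to subalgebras of products of copies of $\mathbf M_0,\dots,\mathbf M_n$ (this is the variety generated by the default bilattice $\mathbf J_n$). Let $g_k\colon\mathbf M_k\to\mathbf M_0$ ($k\in[1,n]$) be the homomorphism $\top^k\mapsto\top^0$, $\bot^k\mapsto\bot^0$, $\mathbf f^k,\mathbf 0^k\mapsto\mathbf f^0$, $\mathbf t^k,\mathbf 1^k\mapsto\mathbf t^0$. Relations: $\leqslant^0$ is the knowledge order of $\mathbf M_0$; for $k\in[1,n]$, $\leqslant^k$ is the order on $M_k$ whose only strict comparabilities are $\mathbf f^k<\mathbf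 0^k$, $\mathbf t^k<\mathbf 1^k$; for $1\le j<k\le n$, ${\leqslant^{jk}}=\{(\top^j,\top^k),(\bot^j,\bot^k),(\mathbf f^j,\mathbf f^k),(\mathbf f^j,\mathbf 0^k),(\mathbf 0^j,\mathbf 0^k),(\mathbf t^j,\mathbf t^k),(\mathbf t^j,\mathbf 1^k),(\mathbf 1^j,\mathbf 1^k)\}$. $\underset{\sim}{\mathbf M}_n$ is the multi-sorted structure with sorts $M_0,\dots,M_n$, operations $g_k$, relations $\leqslant^k$, $\leqslant^{jk}$, discrete topologies. Multi-sorted topological structures $\mathbb X$ in this signature have disjoint topological sorts $X_0,\dots,X_n$ (disjoint-union topology on $X=X_0\cup\dots\cup X_n$), maps $g_k\colon X_k\to X_0$, relations $\leqslant^k\subseteq X_k^2$, $\leqslant^{jk}\subseteq X_j\times X_k$; morphisms are continuous sort-preserving maps preserving operations and relations. $\mathcal X_n$ is the category of structures isomorphic to topologically closed substructures of non-empty powers $\underset{\sim}{\mathbf M}_n^S$ (sortwise powers, pointwise structure, product topology), with these morphisms. For $\mathbf A\in\mathcal V_n$, $\mathrm D(\mathbf A)\in\mathcal X_n$ has sorts $X_k=\{\text{homomorphisms }\mathbf A\to\mathbf M_k\}$ with the topology inherited from $M_k^A$, $g_k(x)=g_k\circ x$, and relations defined pointwise ($x\leqslant^{jk}y$ iff $x(a)\leqslant^{jk}y(a)$ for all $a\in A$). For $\mathbb X\in\mathcal X_n$, let $X=X_0\cup\dots\cup X_n$, define $\le$ on $X$ by $x\le y$ iff either $x,y\in X_k$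 and $x\leqslant^k y$ for some $k\in[0,n]$, or $x\in X_j$, $y\in X_k$, $x\leqslant^{jk}y$ for some $1\le j<k\le n$, and let $g\colon X\to X$ be $g_k$ on $X_k$ ($k\ge1$) and the identity on $X_0$. Then $\mathrm P(\mathbb X)=\langle X\,\dot\cup\,\widehat X;\preccurlyeq,\mathscr T\rangle$ where $\widehat X=\{\widehat x\mid x\in X\}$ is a disjoint copy of $X$, $\mathscr T$ is the disjoint-union topology, and $\preccurlyeq$ is given by: (1) for $x,y\in X$: $x\preccurlyeq y$ iff $x\le y$; (2) $\widehat x\preccurlyeq\widehat y$ iff $x\ge y$; (3) for $x\in X\setminus X_0$, $y\in X_0$: $x\preccurlyeq y$ iff $g(x)\le y$; (4) for $x\in X\setminus X_0$, $\widehat y\in\widehat X_0$: $x\preccurlyeq\widehat y$ iff $g(x)\ge y$; (5) for $x\in X_0$, $\widehat y\in\widehat X\setminus\widehat X_0$: $x\preccurlyeq\widehat y$ iff $x\le g(y)$; (6) for $\widehat x\in\widehat X_0$, $\widehat y\in\widehat X\setminus\widehat X_0$: $\widehat x\preccurlyeq\widehat y$ iff $x\ge g(y)$; (7) for $x\in X\setminus X_0$, $\widehat y\in\widehat X\setminus\widehat X_0$: $x\preccurlyeq\widehat y$ iff $g(x)\le g(y)$ or $g(x)\ge g(y)$; no other pairs are related. For a morphism $\varphi$, $\mathrm P(\varphi)(x)=\varphi(x)$ and $\mathrm P(\varphi)(\widehat x)=\widehat{\varphi(x)}$. $\mathcal P$ is the category of Priestley spaces (compact, totally order-disconnected ordered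 topological spaces) with continuous order-preserving maps. For a bounded distributive lattice $\mathbf L$, $\mathrm H(\mathbf L)$ is the set of bounded lattice homomorphisms $\mathbf L\to\{0,1\}$ with the pointwise order and the topology inherited from $\{0,1\}^L$ (discrete $\{0,1\}$). Isomorphism of Priestley spaces means order-isomorphism that is a homeomorphism. *)

theory Defs
  imports "HOL-Analysis.Analysis"
begin

datatype mel = Top | Bot | Fv | Tv | Zv | Ov

text \<open>Universe of M_k (only meaningful for k in [0,n]).\<close>
definition Mset :: "nat \<Rightarrow> mel set" where
  "Mset k = (if k = 0 then {Top, Bot, Fv, Tv} else UNIV)"

text \<open>Knowledge order of M_k (generated by Bot<Fv<Zv<Top, Bot<Tv<Ov<Top;
  on M_0 it restricts to the knowledge order of M_0).\<close>
definition kle :: "mel \<Rightarrow> mel \<Rightarrow> bool" where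
  "kle a b \<longleftrightarrow> a = b \<or> a = Bot \<or> b = Top \<or> (a = Fv \<and> b = Zv) \<or> (a = Tv \<and> b = Ov)"

text \<open>Truth order of M_k (generated by Zv<Fv<Top<Tv<Ov and Fv<Bot<Tv).\<close>
definition tle :: "mel \<Rightarrow> mel \<Rightarrow> bool" where
  "tle a b \<longleftrightarrow> a = b \<or> a = Zv \<or> b = Ov \<or> (a = Fv \<and> b \<in> {Top, Bot, Tv})
      \<or> (b = Tv \<and> a \<in> {Top, Bot, Fv})"

definition omeet :: "(mel \<Rightarrow> mel \<Rightarrow> bool) \<Rightarrow> mel set \<Rightarrow> mel \<Rightarrow> mel \<Rightarrow> mel" where
  "omeet le U a b = (THE c. c \<in> U \<and> le c a \<and> le c b \<and> (\<forall>d\<in>U. le d a \<and> le d b \<longrightarrow> le d c))"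

definition ojoin :: "(mel \<Rightarrow> mel \<Rightarrow> bool) \<Rightarrow> mel set \<Rightarrow> mel \<Rightarrow> mel \<Rightarrow> mel" where
  "ojoin le U a b = (THE c. c \<in> U \<and> le a c \<and> le b c \<and> (\<forall>d\<in>U. le a d \<and> le b d \<longrightarrow> le c d))"

fun mneg :: "mel \<Rightarrow> mel" where
  "mneg Fv = Tv" | "mneg Tv = Fv" | "mneg Zv = Ov" | "mneg Ov = Zv"
| "mneg Top = Top" | "mneg Bot = Bot"

record 'a alg =
  acarrier :: "'a set"
  akmeet :: "'a \<Rightarrow> 'a \<Rightarrow> 'a"
  akjoin :: "'a \<Rightarrow> 'a \<Rightarrow> 'a"
  atmeet :: "'a \<Rightarrow> 'a \<Rightarrow> 'a"
  atjoin :: "'a \<Rightarrow> 'a \<Rightarrow> 'a"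
  aneg :: "'a \<Rightarrow> 'a"
  atop :: "'a"
  abot :: "'a"
  afc :: "nat \<Rightarrow> 'a"
  atc :: "nat \<Rightarrow> 'a"

definition Malg :: "nat \<Rightarrow> mel alg" where
  "Malg k = \<lparr> acarrier = Mset k,
     akmeet = omeet kle (Mset k), akjoin = ojoin kle (Mset k),
     atmeet = omeet tle (Mset k), atjoin = ojoin tle (Mset k),
     aneg = mneg, atop = Top, abot = Bot,
     afc = (\<lambda>i. if i < k then Zv else Fv),
     atc = (\<lambda>i. if i < k then Ov else Tv) \<rparr>"

definition is_alg :: "nat \<Rightarrow> 'a alg \<Rightarrow> bool" where
  "is_alg n A \<longleftrightarrow>
     (\<forall>x\<in>acarrier A. \<forall>y\<in>acarrier A.
        akmeet A x y \<in> acarrier A \<and> akjoin A x y \<in> acarrier A \<and>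
        atmeet A x y \<in> acarrier A \<and> atjoin A x y \<in> acarrier A) \<and>
     (\<forall>x\<in>acarrier A. aneg A x \<in> acarrier A) \<and>
     atop A \<in> acarrier A \<and> abot A \<in> acarrier A \<and>
     (\<forall>i\<le>n. afc A i \<in> acarrier A \<and> atc A i \<in> acarrier A)"

definition alg_hom :: "nat \<Rightarrow> 'a alg \<Rightarrow> 'b alg \<Rightarrow> ('a \<Rightarrow> 'b) \<Rightarrow> bool" where
  "alg_hom n A B h \<longleftrightarrow>
     h ` acarrier A \<subseteq> acarrier B \<and>
     (\<forall>x\<in>acarrier A. \<forall>y\<in>acarrier A.
        h (akmeet A x y) = akmeet B (h x) (h y) \<and> h (akjoin A x y) = akjoin B (h x) (h y) \<and>
        h (atmeet A x y) = atmeet B (h x) (h y) \<and> h (atjoin A x y) = atjoin B (h x) (h y)) \<and>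
     (\<forall>x\<in>acarrier A. h (aneg A x) = aneg B (h x)) \<and>
     h (atop A) = atop B \<and> h (abot A) = abot B \<and>
     (\<forall>i\<le>n. h (afc A i) = afc B i \<and> h (atc A i) = atc B i)"

definition prodalg :: "'i set \<Rightarrow> ('i \<Rightarrow> nat) \<Rightarrow> ('i \<Rightarrow> mel) alg" where
  "prodalg I \<kappa> = \<lparr> acarrier = (\<Pi>\<^sub>E i\<in>I. Mset (\<kappa> i)),
     akmeet = (\<lambda>x y. \<lambda>i\<in>I. akmeet (Malg (\<kappa> i)) (x i) (y i)),
     akjoin = (\<lambda>x y. \<lambda>i\<in>I. akjoin (Malg (\<kappa> i)) (x i) (y i)),
     atmeet = (\<lambda>x y. \<lambda>i\<in>I. atmeet (Malg (\<kappa> i)) (x i) (y i)),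
     atjoin = (\<lambda>x y. \<lambda>i\<in>I. atjoin (Malg (\<kappa> i)) (x i) (y i)),
     aneg = (\<lambda>x. \<lambda>i\<in>I. aneg (Malg (\<kappa> i)) (x i)),
     atop = (\<lambda>i\<in>I. atop (Malg (\<kappa> i))),
     abot = (\<lambda>i\<in>I. abot (Malg (\<kappa> i))),
     afc = (\<lambda>j. \<lambda>i\<in>I. afc (Malg (\<kappa> i)) j),
     atc = (\<lambda>j. \<lambda>i\<in>I. atc (Malg (\<kappa> i)) j) \<rparr>"

text \<open>A is in V_n: it is (isomorphic to) a subalgebra of a product of copies of
  M_0..M_n, i.e. it embeds into such a product, the index set having type 'i.
  The main theorem quantifies over all index types 'i.\<close>
definition in_Vn :: "nat \<Rightarrow> 'i itself \<Rightarrow> 'a alg \<Rightarrow> bool" where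
  "in_Vn n _ A \<longleftrightarrow> is_alg n A \<and>
     (\<exists>(I::'i set) \<kappa> h. (\<forall>i\<in>I. \<kappa> i \<le> n) \<and> alg_hom n A (prodalg I \<kappa>) h \<and> inj_on h (acarrier A))"

fun gM :: "mel \<Rightarrow> mel" where
  "gM Zv = Fv" | "gM Ov = Tv" | "gM Fv = Fv" | "gM Tv = Tv" | "gM Top = Top" | "gM Bot = Bot"

text \<open>The relations of the alter ego: relM 0 0 is the knowledge order of M_0,
  relM k k (k>0) is the order with only Fv<Zv, Tv<Ov, and relM j k (1<=j<k) the
  relation \<leqslant>^jk.\<close>
definition relM :: "nat \<Rightarrow> nat \<Rightarrow> mel \<Rightarrow> mel \<Rightarrow> bool" where
  "relM j k a b =
     (if j = k then (if k = 0 then kle a b else (a = b \<or> (a = Fv \<and> b = Zv) \<or> (a = Tv \<and> b = Ov)))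
      else (a, b) \<in> {(Top,Top),(Bot,Bot),(Fv,Fv),(Fv,Zv),(Zv,Zv),(Tv,Tv),(Tv,Ov),(Ov,Ov)})"

text \<open>Multi-sorted topological structures: sorts X_0..X_n, topology on their union,
  maps g_k (gmap k), relations \<leqslant>^k (mrel k k) and \<leqslant>^jk (mrel j k, 1<=j<k).\<close>
record 'x mstruct =
  sorts :: "nat \<Rightarrow> 'x set"
  mtop :: "'x topology"
  gmap :: "nat \<Rightarrow> 'x \<Rightarrow> 'x"
  mrel :: "nat \<Rightarrow> nat \<Rightarrow> 'x \<Rightarrow> 'x \<Rightarrow> bool"

definition morph :: "nat \<Rightarrow> 'x mstruct \<Rightarrow> 'y mstruct \<Rightarrow> ('x \<Rightarrow> 'y) \<Rightarrow> bool" where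
  "morph n X Y \<phi> \<longleftrightarrow>
     continuous_map (mtop X) (mtop Y) \<phi> \<and>
     (\<forall>k\<le>n. \<phi> ` sorts X k \<subseteq> sorts Y k) \<and>
     (\<forall>k\<in>{1..n}. \<forall>x\<in>sorts X k. \<phi> (gmap X k x) = gmap Y k (\<phi> x)) \<and>
     (\<forall>k\<le>n. \<forall>x\<in>sorts X k. \<forall>y\<in>sorts X k. mrel X k k x y \<longrightarrow> mrel Y k k (\<phi> x) (\<phi> y)) \<and>
     (\<forall>j k. 1 \<le> j \<and> j < k \<and> k \<le> n \<longrightarrow>
        (\<forall>x\<in>sorts X j. \<forall>y\<in>sorts X k. mrel X j k x y \<longrightarrow> mrel Y j k (\<phi> x) (\<phi> y)))"

definition iso_pair :: "nat \<Rightarrow> 'x mstruct \<Rightarrow> 'y mstruct \<Rightarrow> ('x \<Rightarrow> 'y) \<Rightarrow> ('y \<Rightarrow> 'x) \<Rightarrow> bool" where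
  "iso_pair n X Y \<phi> \<psi> \<longleftrightarrow> morph n X Y \<phi> \<and> morph n Y X \<psi> \<and>
     (\<forall>x\<in>topspace (mtop X). \<psi> (\<phi> x) = x) \<and> (\<forall>y\<in>topspace (mtop Y). \<phi> (\<psi> y) = y)"

definition powstruct :: "nat \<Rightarrow> 's set \<Rightarrow> (nat \<times> ('s \<Rightarrow> mel)) mstruct" where
  "powstruct n S = \<lparr>
     sorts = (\<lambda>k. if k \<le> n then {k} \<times> (\<Pi>\<^sub>E s\<in>S. Mset k) else {}),
     mtop = sum_topology (\<lambda>k. product_topology (\<lambda>s. discrete_topology (Mset k)) S) {..n},
     gmap = (\<lambda>k p. (0, \<lambda>s\<in>S. gM (snd p s))),
     mrel = (\<lambda>j k p q. \<forall>s\<in>S. relM j k (snd p s) (snd q s)) \<rparr>"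

definition substruct :: "'x mstruct \<Rightarrow> 'x set \<Rightarrow> 'x mstruct" where
  "substruct X Y = \<lparr> sorts = (\<lambda>k. sorts X k \<inter> Y), mtop = subtopology (mtop X) Y,
     gmap = gmap X, mrel = mrel X \<rparr>"

definition closed_substruct :: "nat \<Rightarrow> 'x mstruct \<Rightarrow> 'x set \<Rightarrow> bool" where
  "closed_substruct n X Y \<longleftrightarrow> Y \<subseteq> topspace (mtop X) \<and> closedin (mtop X) Y \<and>
     (\<forall>k\<in>{1..n}. \<forall>y\<in>sorts X k \<inter> Y. gmap X k y \<in> Y)"

text \<open>X is in \<X>_n: isomorphic to a topologically closed substructure of a non-empty
  power of the alter ego (index set of type 's; the theorem quantifies over all 's).\<close>
definition in_Xn :: "nat \<Rightarrow> 's itself \<Rightarrow> 'x mstruct \<Rightarrow> bool" where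
  "in_Xn n _ X \<longleftrightarrow> (\<forall>k\<le>n. sorts X k \<subseteq> topspace (mtop X)) \<and>
     (\<exists>(S::'s set) Y \<phi> \<psi>. S \<noteq> {} \<and> closed_substruct n (powstruct n S) Y \<and>
        iso_pair n X (substruct (powstruct n S) Y) \<phi> \<psi>)"

definition Dhoms :: "nat \<Rightarrow> 'a alg \<Rightarrow> (nat \<times> ('a \<Rightarrow> mel)) set" where
  "Dhoms n A = {(k, x) | k x. k \<le> n \<and> x \<in> extensional (acarrier A) \<and> alg_hom n A (Malg k) x}"

definition Dfun :: "nat \<Rightarrow> 'a alg \<Rightarrow> (nat \<times> ('a \<Rightarrow> mel)) mstruct" where
  "Dfun n A = substruct (powstruct n (acarrier A)) (Dhoms n A)"

definition sle :: "nat \<Rightarrow> 'x mstruct \<Rightarrow> 'x \<Rightarrow> 'x \<Rightarrow> bool" where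
  "sle n X x y \<longleftrightarrow>
     (\<exists>k\<le>n. x \<in> sorts X k \<and> y \<in> sorts X k \<and> mrel X k k x y) \<or>
     (\<exists>j k. 1 \<le> j \<and> j < k \<and> k \<le> n \<and> x \<in> sorts X j \<and> y \<in> sorts X k \<and> mrel X j k x y)"

definition allpts :: "nat \<Rightarrow> 'x mstruct \<Rightarrow> 'x set" where
  "allpts n X = (\<Union>k\<le>n. sorts X k)"

definition gfun :: "nat \<Rightarrow> 'x mstruct \<Rightarrow> 'x \<Rightarrow> 'x" where
  "gfun n X x = (if x \<in> sorts X 0 then x
                 else gmap X (SOME k. 1 \<le> k \<and> k \<le> n \<and> x \<in> sorts X k) x)"

text \<open>Points of P(X): (False, x) is x \<in> X, (True, x) is the copy x-hat.\<close>
definition Ptop :: "'x mstruct \<Rightarrow> (bool \<times> 'x) topology" where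
  "Ptop X = sum_topology (\<lambda>b. mtop X) UNIV"

definition Ple :: "nat \<Rightarrow> 'x mstruct \<Rightarrow> bool \<times> 'x \<Rightarrow> bool \<times> 'x \<Rightarrow> bool" where
  "Ple n X p q = (let x = snd p; y = snd q; X0 = sorts X 0; le = sle n X; g = gfun n X in
     x \<in> allpts n X \<and> y \<in> allpts n X \<and>
     (if \<not> fst p \<and> \<not> fst q then
        le x y \<or> (x \<notin> X0 \<and> y \<in> X0 \<and> le (g x) y)
      else if fst p \<and> fst q then
        le y x \<or> (x \<in> X0 \<and> y \<notin> X0 \<and> le (g y) x)
      else if \<not> fst p \<and> fst q then
        (x \<notin> X0 \<and> y \<in> X0 \<and> le y (g x)) \<or>
        (x \<in> X0 \<and> y \<notin> X0 \<and> le x (g y)) \<or>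
        (x \<notin> X0 \<and> y \<notin> X0 \<and> (le (g x) (g y) \<or> le (g y) (g x)))
      else False))"

definition Pmap :: "('x \<Rightarrow> 'y) \<Rightarrow> bool \<times> 'x \<Rightarrow> bool \<times> 'y" where
  "Pmap \<phi> p = (fst p, \<phi> (snd p))"

definition priestley :: "'p topology \<Rightarrow> ('p \<Rightarrow> 'p \<Rightarrow> bool) \<Rightarrow> bool" where
  "priestley T le \<longleftrightarrow>
     (\<forall>x\<in>topspace T. le x x) \<and>
     (\<forall>x\<in>topspace T. \<forall>y\<in>topspace T. le x y \<and> le y x \<longrightarrow> x = y) \<and>
     (\<forall>x\<in>topspace T. \<forall>y\<in>topspace T. \<forall>z\<in>topspace T. le x y \<and> le y z \<longrightarrow> le x z) \<and>
     compact_space T \<and>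
     (\<forall>x\<in>topspace T. \<forall>y\<in>topspace T. \<not> le x y \<longrightarrow>
        (\<exists>U. openin T U \<and> closedin T U \<and>
             (\<forall>a\<in>U. \<forall>b\<in>topspace T. le a b \<longrightarrow> b \<in> U) \<and> x \<in> U \<and> y \<notin> U))"

definition Hset :: "'a alg \<Rightarrow> ('a \<Rightarrow> bool) set" where
  "Hset A = {h \<in> extensional (acarrier A).
     (\<forall>x\<in>acarrier A. \<forall>y\<in>acarrier A. h (atmeet A x y) = (h x \<and> h y) \<and>
                                     h (atjoin A x y) = (h x \<or> h y)) \<and>
     h (afc A 0) = False \<and> h (atc A 0) = True}"

definition Htop :: "'a alg \<Rightarrow> ('a \<Rightarrow> bool) topology" where
  "Htop A = subtopology (product_topology (\<lambda>a. discrete_topology (UNIV::bool set)) (acarrier A)) (Hset A)"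

definition Hle :: "'a alg \<Rightarrow> ('a \<Rightarrow> bool) \<Rightarrow> ('a \<Rightarrow> bool) \<Rightarrow> bool" where
  "Hle A h h' \<longleftrightarrow> (\<forall>a\<in>acarrier A. h a \<longrightarrow> h' a)"

end

theory Submission
  imports Defs
begin

text \<open>
  For an object embedded in a power of the alter ego the order of \<open>P(X)\<close> is given by an explicit formula
  \<open>pow_le\<close> in the values of the points, and any two points that are not related are separated by a
  clopen up-set depending on at most two coordinates; this makes \<open>P(X)\<close> a Priestley space.

  For the isomorphism, a homomorphism \<open>x\<close> into \<open>M_k\<close> is composed with a prime filter of the truth lattice
  of \<open>M_k\<close>, which gives two points of \<open>H(A)\<close> for each \<open>x\<close>, one for \<open>x\<close> and one for its hatted copy.
  A few unary and binary terms of the algebra show that this map reflects the order. Its image is closed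
  because \<open>P(D(A))\<close> is compact, and dense because the prime filters of each \<open>M_k\<close> separate
  points of the lattice reduct of \<open>A\<close>; hence it is onto.
\<close>

subsection \<open>Sum topologies and locally constant maps\<close>

text \<open>The doubling of points and the shape of the order come from the prime filters of the
  truth lattice of \<open>M_k\<close>. For k > 0 there are four: \<open>{Ov}\<close> inside each of
  \<open>{Ov, Tv, Top}\<close> and \<open>{Ov, Tv, Bot}\<close>, and both of these inside the
  complement of \<open>{Zv}\<close>. The two middle ones are pulled back along \<open>gM\<close>, so
  they belong to g(x) and its copy; the outer two are left for x and its copy. Hence x lies below
  both g(x) and the copy of g(x), and the copy of x lies above both. Negation exchanges the two
  flags and reverses inclusion, which is why passing to copies reverses the order and why hatted
  pairs reduce to unhatted ones. The delicate comparison is between x and the copy of y, both of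
  positive sort. There the order is a disjunction of two universally quantified comparisons, so its
  failure has two independent witnesses. This is why a separating up-set may need two coordinates,
  and why a binary term is needed to merge two elements of the algebra into one.\<close>

lemma continuous_map_from_sum_topology:
  "continuous_map (sum_topology X I) Y f \<longleftrightarrow> (\<forall>i\<in>I. continuous_map (X i) Y (\<lambda>x. f (i, x)))"
proof
  assume "continuous_map (sum_topology X I) Y f"
  then show "\<forall>i\<in>I. continuous_map (X i) Y (\<lambda>x. f (i, x))"
    using continuous_map_compose[OF continuous_map_component_injection] by (fastforce simp: o_def)
next
  assume R: "\<forall>i\<in>I. continuous_map (X i) Y (\<lambda>x. f (i, x))"
  show "continuous_map (sum_topology X I) Y f"
    unfolding continuous_map
  proof (intro conjI allI impI)
    show "f ` topspace (sum_topology X I) \<subseteq> topspace Y"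
      using R by (fastforce simp: continuous_map_def)
    fix U assume "openin Y U"
    then have "\<forall>i\<in>I. openin (X i) {x \<in> topspace (X i). f (i, x) \<in> U}"
      using R by (auto simp: continuous_map_def)
    moreover have "{x. (i, x) \<in> {z \<in> topspace (sum_topology X I). f z \<in> U}} =
        {x \<in> topspace (X i). f (i, x) \<in> U}" if "i \<in> I" for i
      using that by auto
    ultimately show "openin (sum_topology X I) {z \<in> topspace (sum_topology X I). f z \<in> U}"
      by (auto simp: openin_sum_topology)
  qed
qed

lemma compact_space_sum_topology:
  assumes "finite I" "\<And>i. i \<in> I \<Longrightarrow> compact_space (X i)"
  shows "compact_space (sum_topology X I)"
proof -
  have "compactin (sum_topology X I) (Pair i ` topspace (X i))" if "i \<in> I" for i
    using image_compactin continuous_map_component_injection that assms(2) compact_space_def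
    by metis
  then have "compactin (sum_topology X I) (\<Union>i\<in>I. Pair i ` topspace (X i))"
    using assms(1) by (intro compactin_Union) auto
  moreover have "(\<Union>i\<in>I. Pair i ` topspace (X i)) = topspace (sum_topology X I)"
    by auto
  ultimately show ?thesis
    by (simp add: compact_space_def)
qed

text \<open>With the discrete space on the whole type as codomain, flags, sorts, values and truth
  values can be combined by arbitrary functions without continuity conditions, and predicates yield
  clopen sets.\<close>

definition locally_constant :: "'x topology \<Rightarrow> ('x \<Rightarrow> 'v) \<Rightarrow> bool" where
  "locally_constant T f \<longleftrightarrow> continuous_map T (discrete_topology UNIV) f"

lemma locally_constant_comp2:
  assumes "locally_constant T f" "locally_constant T g"
  shows "locally_constant T (\<lambda>x. H (f x) (g x))"
proof -
  have "continuous_map T (discrete_topology UNIV) (\<lambda>x. (f x, g x))"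
    using continuous_map_pairedI[OF assms[unfolded locally_constant_def]]
    by (metis prod_topology_discrete_topology UNIV_Times_UNIV)
  moreover have "continuous_map (discrete_topology UNIV) (discrete_topology UNIV) (\<lambda>(u, v). H u v)"
    by (simp add: continuous_map_def)
  ultimately show ?thesis
    using continuous_map_compose[of T "discrete_topology UNIV" "\<lambda>x. (f x, g x)"
        "discrete_topology UNIV" "\<lambda>(u, v). H u v"]
    by (simp add: locally_constant_def o_def)
qed

text \<open>The partial application \<open>H (f x) (g x)\<close> is a function-valued locally
  constant map; it is combined with \<open>h\<close> by function application.\<close>

lemma locally_constant_comp3:
  assumes "locally_constant T f" "locally_constant T g" "locally_constant T h"
  shows "locally_constant T (\<lambda>x. H (f x) (g x) (h x))"
  using locally_constant_comp2[OF locally_constant_comp2[OF assms(1,2), of H] assms(3), of "\<lambda>u v. u v"]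
  by simp

lemma locally_constant_comp4:
  assumes "locally_constant T f" "locally_constant T g" "locally_constant T h" "locally_constant T k"
  shows "locally_constant T (\<lambda>x. H (f x) (g x) (h x) (k x))"
  using locally_constant_comp2[OF locally_constant_comp3[OF assms(1-3), of H] assms(4), of "\<lambda>u v. u v"]
  by simp

lemma locally_constant_subtopology:
  "locally_constant T f \<Longrightarrow> locally_constant (subtopology T Y) f"
  by (simp add: locally_constant_def continuous_map_from_subtopology)

lemma locally_constant_clopen:
  assumes "locally_constant T P"
  shows "openin T {x \<in> topspace T. P x}" "closedin T {x \<in> topspace T. P x}"
  using openin_continuous_map_preimage[of T "discrete_topology UNIV" P "{True}"]
    closedin_continuous_map_preimage[of T "discrete_topology UNIV" P "{True}"] assms
  by (auto simp: locally_constant_def)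

lemma topspace_Ptop [simp]: "topspace (Ptop X) = UNIV \<times> topspace (mtop X)"
  by (auto simp: Ptop_def)

lemma compact_space_Ptop: "compact_space (mtop X) \<Longrightarrow> compact_space (Ptop X)"
  unfolding Ptop_def by (simp add: compact_space_sum_topology)

lemma locally_constant_Ptop_fst: "locally_constant (Ptop X) fst"
  by (simp add: locally_constant_def Ptop_def continuous_map_from_sum_topology)

lemma locally_constant_Ptop_snd:
  "locally_constant (mtop X) f \<Longrightarrow> locally_constant (Ptop X) (\<lambda>p. f (snd p))"
  by (simp add: locally_constant_def Ptop_def continuous_map_from_sum_topology)

subsection \<open>Well-sorted structures and their morphisms\<close>

text \<open>The record type ties sorts, topology and maps together in no way, and
  \<open>in_Xn\<close> only asks that the sorts lie in the space. These properties come from the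
  power through the isomorphism; they make the \<open>SOME\<close> in \<open>gfun\<close>
  determinate and put its value into sort 0.\<close>

definition well_sorted :: "nat \<Rightarrow> 'x mstruct \<Rightarrow> bool" where
  "well_sorted n X \<longleftrightarrow>
     topspace (mtop X) = (\<Union>k\<le>n. sorts X k) \<and>
     (\<forall>j\<le>n. \<forall>k\<le>n. j \<noteq> k \<longrightarrow> sorts X j \<inter> sorts X k = {}) \<and>
     (\<forall>k\<in>{1..n}. \<forall>x\<in>sorts X k. gmap X k x \<in> sorts X 0)"

lemma well_sorted_unique:
  "\<lbrakk>well_sorted n X; x \<in> sorts X j; x \<in> sorts X k; j \<le> n; k \<le> n\<rbrakk> \<Longrightarrow> j = k"
  by (auto simp: well_sorted_def)

lemma well_sorted_allpts: "well_sorted n X \<Longrightarrow> allpts n X = topspace (mtop X)"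
  by (simp add: well_sorted_def allpts_def)

lemma gfun_eq_gmap:
  assumes "well_sorted n X" "1 \<le> k" "k \<le> n" "x \<in> sorts X k"
  shows "gfun n X x = gmap X k x"
proof -
  have "x \<notin> sorts X 0"
    using well_sorted_unique[OF assms(1,4), of 0] assms(2,3) by auto
  moreover have "(SOME k. 1 \<le> k \<and> k \<le> n \<and> x \<in> sorts X k) = k"
    using assms well_sorted_unique[OF assms(1)] by (intro some_equality) auto
  ultimately show ?thesis
    by (simp add: gfun_def)
qed

lemma gfun_in_sort_0:
  assumes "well_sorted n X" "x \<in> topspace (mtop X)"
  shows "gfun n X x \<in> sorts X 0"
proof (cases "x \<in> sorts X 0")
  case False
  then obtain k where "1 \<le> k" "k \<le> n" "x \<in> sorts X k"
    using assms unfolding well_sorted_def by (metis One_nat_def Suc_leI UN_E atMost_iff gr0I)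
  then show ?thesis
    using assms(1) gfun_eq_gmap[OF assms(1)] by (auto simp: well_sorted_def)
qed (simp add: gfun_def)

lemma morph_sorts:
  assumes "morph n X Y \<phi>" "k \<le> n" "x \<in> sorts X k"
  shows "\<phi> x \<in> sorts Y k"
  using assms by (auto simp: morph_def)

text \<open>Clauses of \<open>Ple\<close> also require points to lie outside sort 0, so a morphism
  must reflect sort 0. It does, because it respects every sort and the sorts of the target are
  disjoint.\<close>

lemma morph_sort_0_iff:
  assumes "well_sorted n X" "well_sorted n Y" "morph n X Y \<phi>" "x \<in> topspace (mtop X)"
  shows "\<phi> x \<in> sorts Y 0 \<longleftrightarrow> x \<in> sorts X 0"
proof -
  obtain k where k: "k \<le> n" "x \<in> sorts X k"
    using assms(1,4) by (auto simp: well_sorted_def)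
  then have "\<phi> x \<in> sorts Y k"
    using morph_sorts[OF assms(3)] by blast
  then show ?thesis
    using k well_sorted_unique[OF assms(1), of x 0] well_sorted_unique[OF assms(2), of "\<phi> x" 0] by auto
qed

lemma morph_gfun:
  assumes "well_sorted n X" "well_sorted n Y" "morph n X Y \<phi>" "x \<in> topspace (mtop X)"
  shows "\<phi> (gfun n X x) = gfun n Y (\<phi> x)"
proof (cases "x \<in> sorts X 0")
  case True
  then show ?thesis
    using morph_sort_0_iff[OF assms] by (simp add: gfun_def)
next
  case False
  then obtain k where k: "1 \<le> k" "k \<le> n" "x \<in> sorts X k"
    using assms(1,4) unfolding well_sorted_def by (metis One_nat_def Suc_leI UN_E atMost_iff gr0I)
  then have "\<phi> x \<in> sorts Y k"
    using morph_sorts[OF assms(3)] by blast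
  then show ?thesis
    using gfun_eq_gmap[OF assms(1) k] gfun_eq_gmap[OF assms(2) k(1,2)] assms(3) k
    by (auto simp: morph_def)
qed

lemma morph_sle:
  assumes "morph n X Y \<phi>" "sle n X x y"
  shows "sle n Y (\<phi> x) (\<phi> y)"
  using assms(2) unfolding sle_def
proof (elim disjE exE conjE)
  fix k assume "k \<le> n" "x \<in> sorts X k" "y \<in> sorts X k" "mrel X k k x y"
  then have "\<phi> x \<in> sorts Y k" "\<phi> y \<in> sorts Y k" "mrel Y k k (\<phi> x) (\<phi> y)"
    using assms(1) by (auto simp: morph_def)
  with \<open>k \<le> n\<close> show "(\<exists>k\<le>n. \<phi> x \<in> sorts Y k \<and> \<phi> y \<in> sorts Y k \<and> mrel Y k k (\<phi> x) (\<phi> y)) \<or>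
     (\<exists>j k. 1 \<le> j \<and> j < k \<and> k \<le> n \<and> \<phi> x \<in> sorts Y j \<and> \<phi> y \<in> sorts Y k \<and> mrel Y j k (\<phi> x) (\<phi> y))"
    by blast
next
  fix j k assume jk: "1 \<le> j" "j < k" "k \<le> n" "x \<in> sorts X j" "y \<in> sorts X k" "mrel X j k x y"
  then have "\<phi> x \<in> sorts Y j" "\<phi> y \<in> sorts Y k"
    using morph_sorts[OF assms(1)] by auto
  moreover have "mrel Y j k (\<phi> x) (\<phi> y)"
    using assms(1) jk unfolding morph_def by blast
  ultimately show "(\<exists>k\<le>n. \<phi> x \<in> sorts Y k \<and> \<phi> y \<in> sorts Y k \<and> mrel Y k k (\<phi> x) (\<phi> y)) \<or>
     (\<exists>j k. 1 \<le> j \<and> j < k \<and> k \<le> n \<and> \<phi> x \<in> sorts Y j \<and> \<phi> y \<in> sorts Y k \<and> mrel Y j k (\<phi> x) (\<phi> y))"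
    using jk by blast
qed

lemma morph_Ple:
  assumes "well_sorted n X" "well_sorted n Y" "morph n X Y \<phi>" "Ple n X p q"
  shows "Ple n Y (Pmap \<phi> p) (Pmap \<phi> q)"
proof -
  let ?x = "snd p" and ?y = "snd q"
  have xy: "?x \<in> topspace (mtop X)" "?y \<in> topspace (mtop X)"
    using assms(4) well_sorted_allpts[OF assms(1)] by (auto simp: Ple_def Let_def)
  then have "\<phi> ?x \<in> allpts n Y" "\<phi> ?y \<in> allpts n Y"
    using assms(3) well_sorted_allpts[OF assms(2)] by (auto simp: morph_def continuous_map_def)
  note facts = this assms(4) morph_sle[OF assms(3)]
    morph_sort_0_iff[OF assms(1-3) xy(1)] morph_sort_0_iff[OF assms(1-3) xy(2)]
    morph_gfun[OF assms(1-3) xy(1), symmetric] morph_gfun[OF assms(1-3) xy(2), symmetric]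
  show ?thesis
  proof (cases "fst p"; cases "fst q")
    assume "fst p" "fst q"
    then show ?thesis using facts unfolding Ple_def Let_def Pmap_def fst_conv snd_conv by auto
  next
    assume "fst p" "\<not> fst q"
    then show ?thesis using facts unfolding Ple_def Let_def Pmap_def fst_conv snd_conv by auto
  next
    assume "\<not> fst p" "fst q"
    then show ?thesis using facts unfolding Ple_def Let_def Pmap_def fst_conv snd_conv by auto
  next
    assume "\<not> fst p" "\<not> fst q"
    then show ?thesis using facts unfolding Ple_def Let_def Pmap_def fst_conv snd_conv by auto
  qed
qed

lemma morph_id: "morph n X X id"
  by (simp add: morph_def)

lemma morph_comp:
  assumes "morph n X Y \<phi>" "morph n Y Z \<psi>"
  shows "morph n X Z (\<psi> \<circ> \<phi>)"
proof -
  have cont: "continuous_map (mtop X) (mtop Z) (\<psi> \<circ> \<phi>)"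
    by (rule continuous_map_compose[where X' = "mtop Y"]) (use assms in \<open>simp_all add: morph_def\<close>)
  note \<phi> = morph_sorts[OF assms(1)]
  have g: "(\<psi> \<circ> \<phi>) (gmap X k x) = gmap Z k ((\<psi> \<circ> \<phi>) x)" if "k \<in> {1..n}" "x \<in> sorts X k" for k x
    using assms \<phi>[of k x] that unfolding morph_def by auto
  have r1: "mrel Z k k ((\<psi> \<circ> \<phi>) x) ((\<psi> \<circ> \<phi>) y)"
    if "k \<le> n" "x \<in> sorts X k" "y \<in> sorts X k" "mrel X k k x y" for k x y
    using assms \<phi>[of k] that unfolding morph_def by simp
  have r2: "mrel Z j k ((\<psi> \<circ> \<phi>) x) ((\<psi> \<circ> \<phi>) y)"
    if "1 \<le> j" "j < k" "k \<le> n" "x \<in> sorts X j" "y \<in> sorts X k" "mrel X j k x y" for j k x y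
  proof -
    have "\<phi> x \<in> sorts Y j" "\<phi> y \<in> sorts Y k" using \<phi> that by auto
    moreover have "mrel Y j k (\<phi> x) (\<phi> y)" using assms(1) that unfolding morph_def by blast
    ultimately show ?thesis using assms(2) that(1-3) unfolding morph_def comp_apply by blast
  qed
  show ?thesis
    unfolding morph_def
  proof (intro conjI)
    show "\<forall>k\<le>n. (\<psi> \<circ> \<phi>) ` sorts X k \<subseteq> sorts Z k"
      using \<phi> morph_sorts[OF assms(2)] by auto
    show "\<forall>k\<in>{1..n}. \<forall>x\<in>sorts X k. (\<psi> \<circ> \<phi>) (gmap X k x) = gmap Z k ((\<psi> \<circ> \<phi>) x)"
      using g by blast
    show "\<forall>k\<le>n. \<forall>x\<in>sorts X k. \<forall>y\<in>sorts X k. mrel X k k x y \<longrightarrow> mrel Z k k ((\<psi> \<circ> \<phi>) x) ((\<psi> \<circ> \<phi>) y)"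
      using r1 by blast
    show "\<forall>j k. 1 \<le> j \<and> j < k \<and> k \<le> n \<longrightarrow>
        (\<forall>x\<in>sorts X j. \<forall>y\<in>sorts X k. mrel X j k x y \<longrightarrow> mrel Z j k ((\<psi> \<circ> \<phi>) x) ((\<psi> \<circ> \<phi>) y))"
      using r2 by blast
  qed (rule cont)
qed

lemma continuous_map_Pmap:
  assumes "continuous_map (mtop X) (mtop Y) \<phi>"
  shows "continuous_map (Ptop X) (Ptop Y) (Pmap \<phi>)"
  using continuous_map_compose[OF assms continuous_map_component_injection[of _ UNIV "\<lambda>_. mtop Y"]]
  by (auto simp: Ptop_def Pmap_def continuous_map_from_sum_topology o_def)

lemma well_sorted_substruct_powstruct:
  assumes "closed_substruct n (powstruct n S) Y"
  shows "well_sorted n (substruct (powstruct n S) Y)"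
proof -
  have 1: "topspace (mtop (substruct (powstruct n S) Y)) = (\<Union>k\<le>n. sorts (substruct (powstruct n S) Y) k)"
    by (auto simp: substruct_def powstruct_def)
  have gM0: "gM v \<in> Mset 0" for v
    by (cases v) (auto simp: Mset_def)
  have "gmap (powstruct n S) k x \<in> sorts (powstruct n S) 0" for k x
    using gM0 by (auto simp: powstruct_def)
  then have 2: "\<forall>k\<in>{1..n}. \<forall>x\<in>sorts (powstruct n S) k \<inter> Y. gmap (powstruct n S) k x \<in> sorts (powstruct n S) 0 \<inter> Y"
    using assms by (auto simp: closed_substruct_def)
  show ?thesis
    unfolding well_sorted_def using 1 2 by (auto simp: substruct_def powstruct_def)
qed

lemma iso_pair_well_sorted:
  assumes "iso_pair n X Z \<phi> \<psi>" "well_sorted n Z" "\<forall>k\<le>n. sorts X k \<subseteq> topspace (mtop X)"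
  shows "well_sorted n X"
proof -
  have \<phi>: "morph n X Z \<phi>" and \<psi>: "morph n Z X \<psi>"
    and inv: "\<And>x. x \<in> topspace (mtop X) \<Longrightarrow> \<psi> (\<phi> x) = x"
    using assms(1) by (auto simp: iso_pair_def)
  have "x \<in> (\<Union>k\<le>n. sorts X k)" if x: "x \<in> topspace (mtop X)" for x
  proof -
    have "\<phi> x \<in> topspace (mtop Z)"
      using \<phi> x by (auto simp: morph_def continuous_map_def)
    then obtain k where "k \<le> n" "\<phi> x \<in> sorts Z k"
      using assms(2) by (auto simp: well_sorted_def)
    then show ?thesis
      using morph_sorts[OF \<psi>] inv[OF x] by force
  qed
  moreover have "j = k" if "x \<in> sorts X j" "x \<in> sorts X k" "j \<le> n" "k \<le> n" for x j k
    using that morph_sorts[OF \<phi>] well_sorted_unique[OF assms(2)] by metis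
  moreover have "gmap X k x \<in> sorts X 0" if "k \<in> {1..n}" "x \<in> sorts X k" for k x
  proof -
    have \<phi>x: "\<phi> x \<in> sorts Z k" using that morph_sorts[OF \<phi>] by auto
    \<comment> \<open>The equation of \<open>\<psi>\<close> is the useful one: it exhibits
      \<open>gmap X k x\<close> as the image of a point of sort 0 of \<open>Z\<close>.\<close>
    then have "\<psi> (gmap Z k (\<phi> x)) = gmap X k (\<psi> (\<phi> x))"
      using \<psi> that by (auto simp: morph_def)
    moreover have "\<psi> (\<phi> x) = x"
      using inv that assms(3) by auto
    moreover have "gmap Z k (\<phi> x) \<in> sorts Z 0"
      using assms(2) \<phi>x that by (auto simp: well_sorted_def)
    ultimately show ?thesis
      using morph_sorts[OF \<psi>] by force
  qed
  ultimately show ?thesis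
    using assms(3) unfolding well_sorted_def by blast
qed

lemma in_Xn_well_sorted: "in_Xn n TYPE('s) X \<Longrightarrow> well_sorted n X"
  unfolding in_Xn_def by (blast intro: iso_pair_well_sorted well_sorted_substruct_powstruct)

section \<open>Transport of the Priestley property along isomorphisms\<close>

lemma priestley_transfer:
  assumes "priestley T' le'" "homeomorphic_maps T T' f g"
    and le: "\<And>x y. \<lbrakk>x \<in> topspace T; y \<in> topspace T\<rbrakk> \<Longrightarrow> le x y \<longleftrightarrow> le' (f x) (f y)"
  shows "priestley T le"
proof -
  have f: "continuous_map T T' f" and g: "continuous_map T' T g"
    and gf: "\<And>x. x \<in> topspace T \<Longrightarrow> g (f x) = x" and fg: "\<And>y. y \<in> topspace T' \<Longrightarrow> f (g y) = y"
    using assms(2) by (auto simp: homeomorphic_maps_def)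
  have fT: "f x \<in> topspace T'" if "x \<in> topspace T" for x
    using f that by (auto simp: continuous_map_def)
  have "compact_space T"
    using assms(1,2) homeomorphic_compact_space unfolding priestley_def homeomorphic_space_def by blast
  moreover have "\<exists>U. openin T U \<and> closedin T U \<and>
      (\<forall>a\<in>U. \<forall>b\<in>topspace T. le a b \<longrightarrow> b \<in> U) \<and> x \<in> U \<and> y \<notin> U"
    if xy: "x \<in> topspace T" "y \<in> topspace T" "\<not> le x y" for x y
  proof -
    have "\<not> le' (f x) (f y)" using le xy by simp
    then obtain U where U: "openin T' U" "closedin T' U"
        "\<forall>a\<in>U. \<forall>b\<in>topspace T'. le' a b \<longrightarrow> b \<in> U" "f x \<in> U" "f y \<notin> U"
      using assms(1) fT xy(1,2) unfolding priestley_def by meson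
    show ?thesis
    proof (intro exI[of _ "{z \<in> topspace T. f z \<in> U}"] conjI)
      show "\<forall>a\<in>{z \<in> topspace T. f z \<in> U}. \<forall>b\<in>topspace T. le a b \<longrightarrow> b \<in> {z \<in> topspace T. f z \<in> U}"
        using U(3) le fT by auto
    qed (use U xy f openin_continuous_map_preimage closedin_continuous_map_preimage in auto)
  qed
  moreover have "x = y" if "x \<in> topspace T" "y \<in> topspace T" "le x y" "le y x" for x y
  proof -
    have "f x = f y"
      using that le fT assms(1) unfolding priestley_def by meson
    then show ?thesis using gf that by metis
  qed
  moreover have "le x z"
    if "x \<in> topspace T" "y \<in> topspace T" "z \<in> topspace T" "le x y" "le y z" for x y z
    using that le fT assms(1) unfolding priestley_def by meson
  moreover have "le x x" if "x \<in> topspace T" for x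
    using that le fT assms(1) unfolding priestley_def by meson
  ultimately show ?thesis
    unfolding priestley_def by blast
qed

text \<open>Both \<open>Pmap \<phi>\<close> and its inverse \<open>Pmap \<psi>\<close> preserve the
  order, so preservation in one direction gives reflection in the other.\<close>

lemma iso_pair_priestley:
  assumes "iso_pair n X Z \<phi> \<psi>" "well_sorted n X" "well_sorted n Z" "priestley (Ptop Z) (Ple n Z)"
  shows "priestley (Ptop X) (Ple n X)"
proof (rule priestley_transfer[OF assms(4)])
  have mor: "morph n X Z \<phi>" "morph n Z X \<psi>"
    and inv: "\<And>x. x \<in> topspace (mtop X) \<Longrightarrow> \<psi> (\<phi> x) = x" "\<And>z. z \<in> topspace (mtop Z) \<Longrightarrow> \<phi> (\<psi> z) = z"
    using assms(1) by (auto simp: iso_pair_def)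
  then show "homeomorphic_maps (Ptop X) (Ptop Z) (Pmap \<phi>) (Pmap \<psi>)"
    unfolding homeomorphic_maps_def by (auto simp: morph_def continuous_map_Pmap) (auto simp: Pmap_def)
  fix p q assume pq: "p \<in> topspace (Ptop X)" "q \<in> topspace (Ptop X)"
  have "Pmap \<psi> (Pmap \<phi> r) = r" if "r \<in> topspace (Ptop X)" for r
    using that inv by (auto simp: Pmap_def)
  then show "Ple n X p q \<longleftrightarrow> Ple n Z (Pmap \<phi> p) (Pmap \<phi> q)"
    using morph_Ple[OF assms(2,3) mor(1)] morph_Ple[OF assms(3,2) mor(2)] pq by metis
qed

subsection \<open>The order of \<open>P(X)\<close> for substructures of powers\<close>

text \<open>The map \<open>gM\<close> is the identity on \<open>M_0\<close>, and for \<open>1 \<le> j \<le> k\<close> the relation \<open>relM j k\<close>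
  does not depend on \<open>j\<close> and \<open>k\<close>, so \<open>gle\<close> and \<open>rle\<close> cover all sorts at once.\<close>

definition gle :: "'s set \<Rightarrow> ('s \<Rightarrow> mel) \<Rightarrow> ('s \<Rightarrow> mel) \<Rightarrow> bool" where
  "gle S f h \<longleftrightarrow> (\<forall>s\<in>S. kle (gM (f s)) (gM (h s)))"

definition rle :: "'s set \<Rightarrow> ('s \<Rightarrow> mel) \<Rightarrow> ('s \<Rightarrow> mel) \<Rightarrow> bool" where
  "rle S f h \<longleftrightarrow> (\<forall>s\<in>S. relM 1 1 (f s) (h s))"

text \<open>One formula per pair of flags: since \<open>gM\<close> fixes \<open>M_0\<close>,
  comparison within sort 0 and comparison through g merge into \<open>gle\<close>, and in the mixed
  case the three clauses for sorts zero or positive merge into one disjunction.\<close>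

fun pow_le :: "'s set \<Rightarrow> bool \<times> nat \<times> ('s \<Rightarrow> mel) \<Rightarrow> bool \<times> nat \<times> ('s \<Rightarrow> mel) \<Rightarrow> bool" where
  "pow_le S (False, j, f) (False, k, h) \<longleftrightarrow> k = 0 \<and> gle S f h \<or> 1 \<le> j \<and> j \<le> k \<and> rle S f h"
| "pow_le S (True, j, f) (True, k, h) \<longleftrightarrow> j = 0 \<and> gle S h f \<or> 1 \<le> k \<and> k \<le> j \<and> rle S h f"
| "pow_le S (False, j, f) (True, k, h) \<longleftrightarrow> 1 \<le> j \<and> gle S h f \<or> 1 \<le> k \<and> gle S f h"
| "pow_le S (True, j, f) (False, k, h) \<longleftrightarrow> False"

lemma kle_refl [simp]: "kle a a"
  by (simp add: kle_def)

lemma kle_trans: "kle a b \<Longrightarrow> kle b c \<Longrightarrow> kle a c"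
  by (auto simp: kle_def)

lemma kle_antisym: "kle a b \<Longrightarrow> kle b a \<Longrightarrow> a = b"
  by (auto simp: kle_def)

lemma relM_1_refl [simp]: "relM (Suc 0) (Suc 0) a a"
  by (simp add: relM_def)

lemma relM_1_trans: "relM (Suc 0) (Suc 0) a b \<Longrightarrow> relM (Suc 0) (Suc 0) b c \<Longrightarrow> relM (Suc 0) (Suc 0) a c"
  by (auto simp: relM_def)

lemma relM_1_antisym: "relM (Suc 0) (Suc 0) a b \<Longrightarrow> relM (Suc 0) (Suc 0) b a \<Longrightarrow> a = b"
  by (auto simp: relM_def)

lemma relM_1_gM_eq: "relM (Suc 0) (Suc 0) a b \<Longrightarrow> gM a = gM b"
  by (auto simp: relM_def)

lemma relM_pos: "1 \<le> j \<Longrightarrow> j \<le> k \<Longrightarrow> relM j k a b = relM 1 1 a b"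
  by (cases a; cases b) (auto simp: relM_def)

lemma relM_0: "relM 0 0 a b = kle a b"
  by (simp add: relM_def)

lemma gM_Mset_0: "a \<in> Mset 0 \<Longrightarrow> gM a = a"
  by (auto simp: Mset_def)

lemma gM_gM [simp]: "gM (gM a) = gM a"
  by (cases a) auto

lemma gM_in_Mset_0: "gM a \<in> Mset 0"
  by (cases a) (auto simp: Mset_def)

lemma gle_refl [simp]: "gle S f f"
  by (simp add: gle_def)

lemma rle_refl [simp]: "rle S f f"
  by (simp add: rle_def)

lemma gle_trans: "gle S f h \<Longrightarrow> gle S h w \<Longrightarrow> gle S f w"
  unfolding gle_def using kle_trans by blast

lemma rle_trans: "rle S f h \<Longrightarrow> rle S h w \<Longrightarrow> rle S f w"
  unfolding rle_def using relM_1_trans by fastforce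

text \<open>\<open>relM 1 1\<close> relates only values with the same image under \<open>gM\<close>.
  A step by \<open>rle\<close> can therefore be composed with a \<open>gle\<close> step in either
  direction, as transitivity of \<open>pow_le\<close> requires.\<close>

lemma rle_imp_gle: "rle S f h \<Longrightarrow> gle S f h" "rle S f h \<Longrightarrow> gle S h f"
  unfolding rle_def gle_def using relM_1_gM_eq by fastforce+

lemma pow_le_refl: "pow_le S p p"
  by (cases "(S, p, p)" rule: pow_le.cases) auto

lemma pow_le_flip: "pow_le S (\<not> b, x) (\<not> c, y) \<longleftrightarrow> pow_le S (c, y) (b, x)"
  by (cases x; cases y; cases b; cases c) auto

lemma pow_le_trans:
  assumes "pow_le S p q" "pow_le S q r"
  shows "pow_le S p r"
proof -
  obtain b j f c k h d l w where "p = (b, j, f)" "q = (c, k, h)" "r = (d, l, w)"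
    by (metis prod.exhaust)
  then show ?thesis
    using assms by (cases b; cases c; cases d) (auto intro: gle_trans rle_trans dest: rle_imp_gle)
qed

text \<open>Only for sort 0: there \<open>gM\<close> is the identity, whereas on positive sorts it
  identifies \<open>Fv\<close> with \<open>Zv\<close> and \<open>Tv\<close> with
  \<open>Ov\<close>.\<close>

lemma gle_antisym:
  assumes "gle S f h" "gle S h f" "f \<in> (\<Pi>\<^sub>E s\<in>S. Mset 0)" "h \<in> (\<Pi>\<^sub>E s\<in>S. Mset 0)"
  shows "f = h"
proof (rule PiE_ext[OF assms(3,4)])
  fix s assume "s \<in> S"
  then have "gM (f s) = f s" "gM (h s) = h s"
    using assms(3,4) gM_Mset_0 by blast+
  then show "f s = h s"
    using assms(1,2) \<open>s \<in> S\<close> kle_antisym unfolding gle_def by metis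
qed

lemma rle_antisym:
  assumes "rle S f h" "rle S h f" "f \<in> (\<Pi>\<^sub>E s\<in>S. A)" "h \<in> (\<Pi>\<^sub>E s\<in>S. B)"
  shows "f = h"
  using assms relM_1_antisym by (intro extensionalityI[of _ S]) (auto simp: rle_def PiE_def)

lemma pow_le_antisym:
  assumes "pow_le S (b, j, f) (c, k, h)" "pow_le S (c, k, h) (b, j, f)"
    and "f \<in> (\<Pi>\<^sub>E s\<in>S. Mset j)" "h \<in> (\<Pi>\<^sub>E s\<in>S. Mset k)"
  shows "(b, j, f) = (c, k, h)"
  using assms by (cases b; cases c) (auto dest: gle_antisym rle_antisym)

section \<open>Clopen up-sets separating unrelated points\<close>

lemma gleD: "gle S f h \<Longrightarrow> s \<in> S \<Longrightarrow> kle (gM (f s)) (gM (h s))"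
  by (simp add: gle_def)

lemma rleD: "rle S f h \<Longrightarrow> s \<in> S \<Longrightarrow> relM (Suc 0) (Suc 0) (f s) (h s)"
  by (simp add: rle_def)

lemma rleD_gM: "rle S f h \<Longrightarrow> s \<in> S \<Longrightarrow> gM (f s) = gM (h s)"
  using rleD relM_1_gM_eq by metis

text \<open>\<open>Q\<close> sees only the flag, the sort and the values at \<open>s\<close> and
  \<open>t\<close>; these are locally constant, so it defines a clopen set. Being an up-set is
  demanded for \<open>pow_le\<close> on all triples, hence it passes to every substructure.\<close>

definition separates ::
  "'s set \<Rightarrow> (bool \<Rightarrow> nat \<Rightarrow> mel \<Rightarrow> mel \<Rightarrow> bool) \<Rightarrow> 's \<Rightarrow> 's \<Rightarrow>
   bool \<times> nat \<times> ('s \<Rightarrow> mel) \<Rightarrow> bool \<times> nat \<times> ('s \<Rightarrow> mel) \<Rightarrow> bool" where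
  "separates S Q s t p q \<longleftrightarrow> s \<in> S \<and> t \<in> S \<and>
     (\<forall>b j f c k h. pow_le S (b, j, f) (c, k, h) \<longrightarrow> Q b j (f s) (f t) \<longrightarrow> Q c k (h s) (h t)) \<and>
     (case p of (b, j, f) \<Rightarrow> Q b j (f s) (f t)) \<and> (case q of (c, k, h) \<Rightarrow> \<not> Q c k (h s) (h t))"

text \<open>The six rules are the six disjuncts of \<open>pow_le\<close>, read at the coordinates
  \<open>s\<close> and \<open>t\<close>; the letters of their names give the flags of the smaller
  and the larger point.\<close>

lemma separatesI:
  assumes st: "s \<in> S" "t \<in> S" and pq: "Q b j (f s) (f t)" "\<not> Q c k (h s) (h t)"
    and FF0: "\<And>j u v u' v'. \<lbrakk>kle (gM u) (gM u'); Q False j u v\<rbrakk> \<Longrightarrow> Q False 0 u' v'"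
    and FF1: "\<And>j k u v u' v'. \<lbrakk>1 \<le> j; j \<le> k; relM 1 1 u u'; gM v = gM v'; Q False j u v\<rbrakk>
               \<Longrightarrow> Q False k u' v'"
    and TT0: "\<And>k u v u' v'. \<lbrakk>kle (gM u') (gM u); kle (gM v') (gM v); Q True 0 u v\<rbrakk> \<Longrightarrow> Q True k u' v'"
    and TT1: "\<And>j k u v u' v'. \<lbrakk>1 \<le> k; k \<le> j; gM u = gM u'; gM v = gM v'; Q True j u v\<rbrakk>
               \<Longrightarrow> Q True k u' v'"
    and FT1: "\<And>j k u v u' v'. \<lbrakk>1 \<le> j; kle (gM u') (gM u); kle (gM v') (gM v); Q False j u v\<rbrakk>
               \<Longrightarrow> Q True k u' v'"
    and FT2: "\<And>j k u v u' v'. \<lbrakk>1 \<le> k; kle (gM u) (gM u'); Q False j u v\<rbrakk> \<Longrightarrow> Q True k u' v'"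
  shows "separates S Q s t (b, j, f) (c, k, h)"
proof -
  have "Q c' k' (h' s) (h' t)" if le: "pow_le S (b', j', f') (c', k', h')" and Q: "Q b' j' (f' s) (f' t)"
    for b' j' f' c' k' h'
  proof -
    consider "\<not> b'" "\<not> c'" "k' = 0" "gle S f' h'" | "\<not> b'" "\<not> c'" "1 \<le> j'" "j' \<le> k'" "rle S f' h'"
      | "b'" "c'" "j' = 0" "gle S h' f'" | "b'" "c'" "1 \<le> k'" "k' \<le> j'" "rle S h' f'"
      | "\<not> b'" "c'" "1 \<le> j'" "gle S h' f'" | "\<not> b'" "c'" "1 \<le> k'" "gle S f' h'"
      using le by (cases b'; cases c'; simp only: pow_le.simps) blast+
    then show ?thesis
    proof cases
      case 1 then show ?thesis using FF0[of "f' s" "h' s"] Q gleD[OF _ st(1)] by metis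
    next
      case 2 then show ?thesis
        using FF1[of j' k' "f' s" "h' s" "f' t" "h' t"] Q rleD[OF _ st(1)] rleD_gM[OF _ st(2)] by simp
    next
      case 3 then show ?thesis
        using TT0[of "h' s" "f' s" "h' t" "f' t"] Q gleD[OF _ st(1)] gleD[OF _ st(2)] by simp
    next
      case 4 then show ?thesis
        using TT1[of k' j' "f' s" "h' s" "f' t" "h' t"] Q rleD_gM[OF _ st(1)] rleD_gM[OF _ st(2)] by simp
    next
      case 5 then show ?thesis
        using FT1[of j' "h' s" "f' s" "h' t" "f' t"] Q gleD[OF _ st(1)] gleD[OF _ st(2)] by simp
    next
      case 6 then show ?thesis
        using FT2[of k' "f' s" "h' s" j' "f' t" "h' t"] Q gleD[OF _ st(1)] by simp
    qed
  qed
  then show ?thesis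
    using st pq unfolding separates_def by blast
qed

text \<open>The complement of an up-set is a down-set, and exchanging the two copies turns it into
  an up-set again.\<close>

lemma separates_flip:
  assumes "separates S Q s t (\<not> c, y) (\<not> b, x)"
  shows "separates S (\<lambda>b j u v. \<not> Q (\<not> b) j u v) s t (b, x) (c, y)"
proof -
  have "\<not> Q (\<not> c') k (h s) (h t)" if "pow_le S (b', j, f) (c', k, h)" "\<not> Q (\<not> b') j (f s) (f t)"
    for b' j f c' k h
    using assms that pow_le_flip[of S c' "(k, h)" b' "(j, f)"] unfolding separates_def by blast
  then show ?thesis
    using assms unfolding separates_def by (auto split: prod.splits)
qed

text \<open>No hatted point is below an unhatted one, so each separator may contain all hatted
  points. Where only sorts matter, \<open>s0\<close> is a dummy coordinate.\<close>

lemma separates_unhatted: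
  assumes "S \<noteq> {}" "\<not> pow_le S (False, j, f) (False, k, h)"
  shows "\<exists>Q s t. separates S Q s t (False, j, f) (False, k, h)"
proof -
  obtain s0 where s0: "s0 \<in> S" using assms(1) by blast
  consider "k = 0" "\<not> gle S f h" | "k > 0" "j = 0" | "k > 0" "j > k" | "0 < j" "j \<le> k" "\<not> rle S f h"
    using assms(2) unfolding pow_le.simps by linarith
  then show ?thesis
  proof cases
    case 1
    then obtain s where s: "s \<in> S" "\<not> kle (gM (f s)) (gM (h s))"
      by (auto simp: gle_def)
    have "separates S (\<lambda>c i u v. c \<or> kle (gM (f s)) (gM u)) s s (False, j, f) (False, k, h)"
      using s by (rule_tac separatesI) (auto dest: relM_1_gM_eq intro: kle_trans)
    then show ?thesis by blast
  next
    case 2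
    have "separates S (\<lambda>c i u v. c \<or> i = 0) s0 s0 (False, j, f) (False, k, h)"
      using s0 2 by (rule_tac separatesI) auto
    then show ?thesis by blast
  next
    case 3
    have "separates S (\<lambda>c i u v. c \<or> i = 0 \<or> j \<le> i) s0 s0 (False, j, f) (False, k, h)"
      using s0 3 by (rule_tac separatesI) auto
    then show ?thesis by blast
  next
    case 4
    then obtain s where s: "s \<in> S" "\<not> relM 1 1 (f s) (h s)"
      by (auto simp: rle_def)
    have "separates S (\<lambda>c i u v. c \<or> i = 0 \<or> relM 1 1 (f s) u) s s (False, j, f) (False, k, h)"
      using s 4 by (rule_tac separatesI) (auto intro: relM_1_trans)
    then show ?thesis by blast
  qed
qed

lemma separates_mixed:
  assumes "S \<noteq> {}" "\<not> pow_le S (False, j, f) (True, k, h)"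
  shows "\<exists>Q s t. separates S Q s t (False, j, f) (True, k, h)"
proof -
  obtain s0 where s0: "s0 \<in> S" using assms(1) by blast
  consider "j = 0" "k = 0" | "j = 0" "k > 0" "\<not> gle S f h" | "j > 0" "k = 0" "\<not> gle S h f"
    | "j > 0" "k > 0" "\<not> gle S f h" "\<not> gle S h f"
    using assms(2) unfolding pow_le.simps by linarith
  then show ?thesis
  proof cases
    case 1
    \<comment> \<open>The unhatted points of sort 0 and the hatted points of positive sort form an
      up-set. The next two cases intersect it with, or enlarge it by, a condition on one
      coordinate.\<close>
    have "separates S (\<lambda>c i u v. c \<longleftrightarrow> i > 0) s0 s0 (False, j, f) (True, k, h)"
      using s0 1 by (rule_tac separatesI) auto
    then show ?thesis by blast
  next
    case 2
    then obtain s where s: "s \<in> S" "\<not> kle (gM (f s)) (gM (h s))"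
      by (auto simp: gle_def)
    have "separates S (\<lambda>c i u v. (c \<longleftrightarrow> i > 0) \<and> kle (gM (f s)) (gM u)) s s (False, j, f) (True, k, h)"
      using s 2 by (rule_tac separatesI) (auto dest: relM_1_gM_eq intro: kle_trans)
    then show ?thesis by blast
  next
    case 3
    then obtain s where s: "s \<in> S" "\<not> kle (gM (h s)) (gM (f s))"
      by (auto simp: gle_def)
    have "separates S (\<lambda>c i u v. (c \<longleftrightarrow> i > 0) \<or> kle (gM u) (gM (f s))) s s (False, j, f) (True, k, h)"
      using s 3 by (rule_tac separatesI) (auto dest: relM_1_gM_eq intro: kle_trans)
    then show ?thesis by blast
  next
    case 4
    then obtain s t where s: "s \<in> S" "\<not> kle (gM (f s)) (gM (h s))" and t: "t \<in> S" "\<not> kle (gM (h t)) (gM (f t))"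
      by (auto simp: gle_def)
    let ?above = "\<lambda>u. kle (gM (f s)) (gM u)" and ?below = "\<lambda>v. kle (gM v) (gM (f t))"
    \<comment> \<open>In sort 0, unhatted points must satisfy \<open>?above\<close> and hatted
      points \<open>?below\<close>. An unhatted point of positive sort lies below both copies of its
      image under g, so it must satisfy both; a hatted one lies above both, so either suffices. The
      second point fails \<open>?above\<close> at \<open>s\<close> and \<open>?below\<close> at
      \<open>t\<close>.\<close>
    have "separates S (\<lambda>c i u v. if c then i > 0 \<and> ?above u \<or> ?below v else ?above u \<and> (i = 0 \<or> ?below v))
        s t (False, j, f) (True, k, h)"
      using s t 4 by (rule_tac separatesI) (auto dest: relM_1_gM_eq intro: kle_trans)
    then show ?thesis by blast
  qed
qed

lemma pow_le_separation:
  assumes "S \<noteq> {}" "\<not> pow_le S p q"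
  shows "\<exists>Q s t. separates S Q s t p q"
proof -
  obtain b j f c k h where pq: "p = (b, j, f)" "q = (c, k, h)"
    by (metis prod.exhaust)
  consider "\<not> b" "\<not> c" | "\<not> b" "c" | "b" "\<not> c" | "b" "c" by blast
  then show ?thesis
  proof cases
    case 1
    then have "p = (False, j, f)" "q = (False, k, h)" using pq by auto
    then show ?thesis using separates_unhatted[OF assms(1)] assms(2) by blast
  next
    case 2
    then have "p = (False, j, f)" "q = (True, k, h)" using pq by auto
    then show ?thesis using separates_mixed[OF assms(1)] assms(2) by blast
  next
    case 3
    obtain s0 where "s0 \<in> S" using assms(1) by blast
    then have "separates S (\<lambda>c i u v. c) s0 s0 p q"
      using 3 unfolding pq by (rule_tac separatesI) auto
    then show ?thesis by blast
  next
    case 4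
    then have "\<not> pow_le S (False, k, h) (False, j, f)"
      using assms(2) pq pow_le_flip[of S c "(k, h)" b "(j, f)"] by simp
    then obtain Q s t where "separates S Q s t (False, k, h) (False, j, f)"
      using separates_unhatted[OF assms(1)] by meson
    then have "separates S (\<lambda>b j u v. \<not> Q (\<not> b) j u v) s t p q"
      using separates_flip[of S Q s t c "(k, h)" b "(j, f)"] 4 pq by simp
    then show ?thesis by blast
  qed
qed

lemma topspace_substruct_powstruct:
  "topspace (mtop (substruct (powstruct n S) Y)) = {(k, f). k \<le> n \<and> f \<in> (\<Pi>\<^sub>E s\<in>S. Mset k)} \<inter> Y"
  by (auto simp: substruct_def powstruct_def)

lemma sorts_substruct_powstruct:
  "k \<le> n \<Longrightarrow> x \<in> sorts (substruct (powstruct n S) Y) k \<longleftrightarrow>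
     x \<in> topspace (mtop (substruct (powstruct n S) Y)) \<and> fst x = k"
  by (cases x) (auto simp: substruct_def powstruct_def)

lemma sle_substruct_powstruct:
  fixes S Y n
  defines "X \<equiv> substruct (powstruct n S) Y"
  assumes "(j, f) \<in> topspace (mtop X)" "(k, h) \<in> topspace (mtop X)"
  shows "sle n X (j, f) (k, h) \<longleftrightarrow> j = 0 \<and> k = 0 \<and> gle S f h \<or> 1 \<le> j \<and> j \<le> k \<and> rle S f h"
proof -
  have fh: "j \<le> n" "k \<le> n" "f \<in> (\<Pi>\<^sub>E s\<in>S. Mset j)" "h \<in> (\<Pi>\<^sub>E s\<in>S. Mset k)"
    using assms(2,3) unfolding X_def topspace_substruct_powstruct by auto
  have mrel: "mrel X i l (j, f) (k, h) = (\<forall>s\<in>S. relM i l (f s) (h s))" for i l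
    by (simp add: X_def substruct_def powstruct_def)
  have sorts: "i \<le> n \<Longrightarrow> (j, f) \<in> sorts X i \<longleftrightarrow> i = j" "i \<le> n \<Longrightarrow> (k, h) \<in> sorts X i \<longleftrightarrow> i = k" for i
    using sorts_substruct_powstruct assms(2,3) unfolding X_def by fastforce+
  have "sle n X (j, f) (k, h) \<longleftrightarrow> (j = k \<or> 1 \<le> j \<and> j < k) \<and> mrel X j k (j, f) (k, h)"
    unfolding sle_def using sorts fh(1,2) by (auto dest: less_imp_le_nat less_le_trans)
  also have "\<dots> \<longleftrightarrow> j = 0 \<and> k = 0 \<and> (\<forall>s\<in>S. kle (f s) (h s)) \<or> 1 \<le> j \<and> j \<le> k \<and> rle S f h"
    unfolding mrel rle_def using relM_pos[of j k] relM_0 by (cases "j = 0") auto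
  also have "\<dots> \<longleftrightarrow> j = 0 \<and> k = 0 \<and> gle S f h \<or> 1 \<le> j \<and> j \<le> k \<and> rle S f h"
  proof -
    have "(\<forall>s\<in>S. kle (f s) (h s)) \<longleftrightarrow> gle S f h" if "j = 0" "k = 0"
    proof -
      have "gM (f s) = f s" "gM (h s) = h s" if "s \<in> S" for s
        using fh(3,4) \<open>j = 0\<close> \<open>k = 0\<close> that gM_Mset_0 by blast+
      then show ?thesis by (simp add: gle_def)
    qed
    then show ?thesis by blast
  qed
  finally show ?thesis .
qed

lemma gfun_substruct_powstruct:
  assumes "closed_substruct n (powstruct n S) Y"
    and "(k, f) \<in> topspace (mtop (substruct (powstruct n S) Y))"
  shows "gfun n (substruct (powstruct n S) Y) (k, f) = (0, \<lambda>s\<in>S. gM (f s))"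
proof (cases "k = 0")
  case True
  then have f: "f \<in> (\<Pi>\<^sub>E s\<in>S. Mset 0)"
    using assms(2) unfolding topspace_substruct_powstruct by simp
  have "f = (\<lambda>s\<in>S. gM (f s))"
  proof (rule extensionalityI)
    show "f \<in> extensional S" using f by (simp add: PiE_def)
    show "f s = (\<lambda>s\<in>S. gM (f s)) s" if "s \<in> S" for s
      using gM_Mset_0[OF PiE_mem[OF f that]] that by simp
  qed simp
  then show ?thesis
    using True assms(2) sorts_substruct_powstruct[of 0 n "(k, f)" S Y] by (simp add: gfun_def)
next
  case False
  have k: "k \<le> n" using assms(2) unfolding topspace_substruct_powstruct by simp
  then have "gfun n (substruct (powstruct n S) Y) (k, f) = gmap (substruct (powstruct n S) Y) k (k, f)"
    using False assms sorts_substruct_powstruct[OF k, of "(k, f)" S Y]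
    by (intro gfun_eq_gmap well_sorted_substruct_powstruct) auto
  then show ?thesis by (simp add: substruct_def powstruct_def)
qed

lemma Ple_substruct_powstruct:
  fixes S Y n
  defines "X \<equiv> substruct (powstruct n S) Y"
  assumes Y: "closed_substruct n (powstruct n S) Y"
    and p: "p \<in> topspace (Ptop X)" and q: "q \<in> topspace (Ptop X)"
  shows "Ple n X p q \<longleftrightarrow> pow_le S p q"
proof -
  obtain b j f c k h where pq: "p = (b, j, f)" "q = (c, k, h)"
    by (metis prod.exhaust)
  have x: "(j, f) \<in> topspace (mtop X)" and y: "(k, h) \<in> topspace (mtop X)"
    using p q pq by auto
  have ws: "well_sorted n X"
    using Y well_sorted_substruct_powstruct unfolding X_def by blast
  have all: "(j, f) \<in> allpts n X" "(k, h) \<in> allpts n X"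
    using x y well_sorted_allpts[OF ws] by auto
  have zero: "(j, f) \<in> sorts X 0 \<longleftrightarrow> j = 0" "(k, h) \<in> sorts X 0 \<longleftrightarrow> k = 0"
    using x y sorts_substruct_powstruct[of 0 n] unfolding X_def by fastforce+
  let ?g = "\<lambda>f. \<lambda>s\<in>S. gM (f s)"
  have g: "gfun n X (j, f) = (0, ?g f)" "gfun n X (k, h) = (0, ?g h)"
    using gfun_substruct_powstruct[OF Y] x y unfolding X_def by blast+
  have gx: "(0, ?g f) \<in> topspace (mtop X)" "(0, ?g h) \<in> topspace (mtop X)"
    using gfun_in_sort_0[OF ws x] gfun_in_sort_0[OF ws y] ws unfolding g well_sorted_def by blast+
  have gle_g: "gle S (?g u) v = gle S u v" "gle S u (?g v) = gle S u v" for u v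
    by (simp_all add: gle_def)
  note sle = sle_substruct_powstruct[where n = n and S = S and Y = Y, folded X_def]
  show ?thesis
    unfolding pq Ple_def Let_def fst_conv snd_conv g zero
    using all x y gx
    by (cases b; cases c) (auto simp: sle gle_g)
qed

section \<open>Compactness and locally constant data of powers; the Priestley property\<close>

lemma finite_Mset: "finite (Mset k)"
proof -
  have "(UNIV :: mel set) = {Top, Bot, Fv, Tv, Zv, Ov}"
    using mel.exhaust by blast
  then have "finite (UNIV :: mel set)"
    by (metis finite.emptyI finite.insertI)
  then show ?thesis
    by (rule finite_subset[OF subset_UNIV])
qed

lemma compact_space_powstruct: "compact_space (mtop (powstruct n S))"
  unfolding powstruct_def
  using finite_Mset
  by (auto intro!: compact_space_sum_topology simp: compact_space_product_topology compact_space_discrete_topology)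

lemma locally_constant_powstruct_fst: "locally_constant (mtop (powstruct n S)) fst"
  by (simp add: locally_constant_def powstruct_def continuous_map_from_sum_topology)

lemma locally_constant_powstruct_eval:
  assumes "s \<in> S"
  shows "locally_constant (mtop (powstruct n S)) (\<lambda>x. snd x s)"
proof -
  have "continuous_map (product_topology (\<lambda>s. discrete_topology (Mset k)) S) (discrete_topology UNIV) (\<lambda>f. f s)" for k
    using continuous_map_product_projection[OF assms, of "\<lambda>s. discrete_topology (Mset k)"]
      subtopology_discrete_topology[of UNIV "Mset k"] continuous_map_into_fulltopology
    by (metis inf_top_left)
  then show ?thesis
    by (simp add: locally_constant_def powstruct_def continuous_map_from_sum_topology)
qed

lemma locally_constant_Ptop_pow:
  fixes S Y n
  defines "X \<equiv> substruct (powstruct n S) Y"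
  assumes "s \<in> S" "t \<in> S"
  shows "locally_constant (Ptop X) (\<lambda>p. Q (fst p) (fst (snd p)) (snd (snd p) s) (snd (snd p) t))"
proof -
  have mtop: "mtop X = subtopology (mtop (powstruct n S)) Y"
    by (simp add: X_def substruct_def)
  have "locally_constant (mtop X) fst" "locally_constant (mtop X) (\<lambda>x. snd x s)" "locally_constant (mtop X) (\<lambda>x. snd x t)"
    unfolding mtop using assms
    by (auto intro: locally_constant_subtopology locally_constant_powstruct_fst locally_constant_powstruct_eval)
  note this[THEN locally_constant_Ptop_snd]
  then show ?thesis
    by (rule locally_constant_comp4[OF locally_constant_Ptop_fst])
qed

lemma compact_space_Ptop_pow:
  assumes "closed_substruct n (powstruct n S) Y"
  shows "compact_space (Ptop (substruct (powstruct n S) Y))"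
  using assms
  by (auto intro!: compact_space_Ptop compact_space_subtopology closedin_compact_space[OF compact_space_powstruct]
      simp: substruct_def closed_substruct_def)

proposition priestley_substruct_powstruct:
  fixes S Y n
  defines "X \<equiv> substruct (powstruct n S) Y"
  assumes "S \<noteq> {}" and Y: "closed_substruct n (powstruct n S) Y"
  shows "priestley (Ptop X) (Ple n X)"
proof -
  note Ple = Ple_substruct_powstruct[OF Y, folded X_def]
  have "p = q" if "p \<in> topspace (Ptop X)" "q \<in> topspace (Ptop X)" "Ple n X p q" "Ple n X q p" for p q
  proof -
    obtain b j f c k h where pq: "p = (b, j, f)" "q = (c, k, h)"
      by (metis prod.exhaust)
    have "f \<in> (\<Pi>\<^sub>E s\<in>S. Mset j)" "h \<in> (\<Pi>\<^sub>E s\<in>S. Mset k)"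
      using that(1,2) unfolding pq X_def topspace_Ptop topspace_substruct_powstruct by auto
    then show ?thesis
      using that(3,4) Ple[OF that(1,2)] Ple[OF that(2,1)] pow_le_antisym unfolding pq by blast
  qed
  moreover have "\<exists>U. openin (Ptop X) U \<and> closedin (Ptop X) U \<and>
      (\<forall>a\<in>U. \<forall>b\<in>topspace (Ptop X). Ple n X a b \<longrightarrow> b \<in> U) \<and> p \<in> U \<and> q \<notin> U"
    if pq: "p \<in> topspace (Ptop X)" "q \<in> topspace (Ptop X)" "\<not> Ple n X p q" for p q
  proof -
    obtain Q s t where sep: "separates S Q s t p q"
      using pow_le_separation[OF assms(2)] pq(3) Ple[OF pq(1,2)] by blast
    define P where "P = (\<lambda>p. Q (fst p) (fst (snd p)) (snd (snd p) s) (snd (snd p) t))"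
    have "locally_constant (Ptop X) P"
      unfolding P_def X_def by (rule locally_constant_Ptop_pow) (use sep in \<open>auto simp: separates_def\<close>)
    note clopen = locally_constant_clopen[OF this]
    have "Q c k (h s) (h t)" if "pow_le S (b, j, f) (c, k, h)" "Q b j (f s) (f t)" for b j f c k h
      using sep that unfolding separates_def by blast
    then have up: "P b" if "pow_le S a b" "P a" for a b
      using that unfolding P_def by (metis prod.collapse)
    show ?thesis
    proof (intro exI[of _ "{x \<in> topspace (Ptop X). P x}"] conjI clopen)
      show "\<forall>a\<in>{x \<in> topspace (Ptop X). P x}. \<forall>b\<in>topspace (Ptop X). Ple n X a b \<longrightarrow> b \<in> {x \<in> topspace (Ptop X). P x}"
        using up Ple by blast
    qed (use pq sep in \<open>auto simp: separates_def P_def\<close>)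
  qed
  moreover have "Ple n X p p" if "p \<in> topspace (Ptop X)" for p
    using Ple[OF that that] pow_le_refl by blast
  moreover have "Ple n X p r" if "p \<in> topspace (Ptop X)" "q \<in> topspace (Ptop X)" "r \<in> topspace (Ptop X)"
    "Ple n X p q" "Ple n X q r" for p q r
    using that Ple pow_le_trans by blast
  ultimately show ?thesis
    unfolding priestley_def using compact_space_Ptop_pow[OF Y, folded X_def] by blast
qed

proposition priestley_P:
  assumes "in_Xn n TYPE('s) X"
  shows "priestley (Ptop X) (Ple n X)"
proof -
  obtain S :: "'s set" and Y \<phi> \<psi> where
    S: "S \<noteq> {}" and Y: "closed_substruct n (powstruct n S) Y"
    and iso: "iso_pair n X (substruct (powstruct n S) Y) \<phi> \<psi>"
    using assms unfolding in_Xn_def by blast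
  show ?thesis
    by (rule iso_pair_priestley[OF iso in_Xn_well_sorted[OF assms] well_sorted_substruct_powstruct[OF Y]
          priestley_substruct_powstruct[OF S Y]])
qed

subsection \<open>Homomorphisms into \<open>M_k\<close>\<close>

text \<open>Explicit forms of the lattice operations. Elements incomparable for knowledge lie on
  different chains, hence the defaults \<open>Bot\<close> and \<open>Top\<close>; for truth the only
  incomparable pair is \<open>Top\<close>, \<open>Bot\<close>, hence \<open>Fv\<close> and
  \<open>Tv\<close>. All defaults lie in \<open>M_0\<close>, so the same formulas serve every
  sort.\<close>

definition kmeet :: "mel \<Rightarrow> mel \<Rightarrow> mel" where
  "kmeet a b = (if kle a b then a else if kle b a then b else Bot)"

definition kjoin :: "mel \<Rightarrow> mel \<Rightarrow> mel" where
  "kjoin a b = (if kle a b then b else if kle b a then a else Top)"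

definition tmeet :: "mel \<Rightarrow> mel \<Rightarrow> mel" where
  "tmeet a b = (if tle a b then a else if tle b a then b else Fv)"

definition tjoin :: "mel \<Rightarrow> mel \<Rightarrow> mel" where
  "tjoin a b = (if tle a b then b else if tle b a then a else Tv)"

lemmas mel_ops = kmeet_def kjoin_def tmeet_def tjoin_def kle_def tle_def

lemma omeet_eqI:
  assumes "c \<in> U" "le c a" "le c b" "\<And>d. \<lbrakk>d \<in> U; le d a; le d b\<rbrakk> \<Longrightarrow> le d c"
    and "\<And>c d. le c d \<Longrightarrow> le d c \<Longrightarrow> c = d"
  shows "omeet le U a b = c"
  unfolding omeet_def by (rule the_equality) (use assms in blast)+

lemma ojoin_eqI:
  assumes "c \<in> U" "le a c" "le b c" "\<And>d. \<lbrakk>d \<in> U; le a d; le b d\<rbrakk> \<Longrightarrow> le c d"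
    and "\<And>c d. le c d \<Longrightarrow> le d c \<Longrightarrow> c = d"
  shows "ojoin le U a b = c"
  unfolding ojoin_def by (rule the_equality) (use assms in blast)+

lemma tle_antisym: "tle a b \<Longrightarrow> tle b a \<Longrightarrow> a = b"
  by (cases a; cases b) (auto simp: tle_def)

lemma Malg_ops:
  assumes "a \<in> Mset k" "b \<in> Mset k"
  shows "akmeet (Malg k) a b = kmeet a b" "akjoin (Malg k) a b = kjoin a b"
    "atmeet (Malg k) a b = tmeet a b" "atjoin (Malg k) a b = tjoin a b"
proof -
  have mem: "kmeet a b \<in> Mset k" "kjoin a b \<in> Mset k" "tmeet a b \<in> Mset k" "tjoin a b \<in> Mset k"
    using assms by (auto simp: kmeet_def kjoin_def tmeet_def tjoin_def Mset_def)
  have "omeet kle (Mset k) a b = kmeet a b"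
  proof (rule omeet_eqI[OF mem(1) _ _ _ kle_antisym])
    fix d assume "kle d a" "kle d b"
    then show "kle d (kmeet a b)" by (cases a; cases b; cases d) (simp_all add: mel_ops)
  qed (cases a; cases b; simp add: mel_ops)+
  then show "akmeet (Malg k) a b = kmeet a b" by (simp add: Malg_def)
  have "ojoin kle (Mset k) a b = kjoin a b"
  proof (rule ojoin_eqI[OF mem(2) _ _ _ kle_antisym])
    fix d assume "kle a d" "kle b d"
    then show "kle (kjoin a b) d" by (cases a; cases b; cases d) (simp_all add: mel_ops)
  qed (cases a; cases b; simp add: mel_ops)+
  then show "akjoin (Malg k) a b = kjoin a b" by (simp add: Malg_def)
  have "omeet tle (Mset k) a b = tmeet a b"
  proof (rule omeet_eqI[OF mem(3) _ _ _ tle_antisym])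
    fix d assume "tle d a" "tle d b"
    then show "tle d (tmeet a b)" by (cases a; cases b; cases d) (simp_all add: mel_ops)
  qed (cases a; cases b; simp add: mel_ops)+
  then show "atmeet (Malg k) a b = tmeet a b" by (simp add: Malg_def)
  have "ojoin tle (Mset k) a b = tjoin a b"
  proof (rule ojoin_eqI[OF mem(4) _ _ _ tle_antisym])
    fix d assume "tle a d" "tle b d"
    then show "tle (tjoin a b) d" by (cases a; cases b; cases d) (simp_all add: mel_ops)
  qed (cases a; cases b; simp add: mel_ops)+
  then show "atjoin (Malg k) a b = tjoin a b" by (simp add: Malg_def)
qed

lemma is_alg_closed:
  assumes "is_alg n A" "a \<in> acarrier A" "b \<in> acarrier A"
  shows "akmeet A a b \<in> acarrier A" "akjoin A a b \<in> acarrier A"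
    "atmeet A a b \<in> acarrier A" "atjoin A a b \<in> acarrier A" "aneg A a \<in> acarrier A"
  using assms by (auto simp: is_alg_def)

lemma is_alg_consts:
  assumes "is_alg n A"
  shows "atop A \<in> acarrier A" "abot A \<in> acarrier A"
    "i \<le> n \<Longrightarrow> afc A i \<in> acarrier A" "i \<le> n \<Longrightarrow> atc A i \<in> acarrier A"
  using assms by (auto simp: is_alg_def)

locale Mhom =
  fixes n :: nat and A :: "'a alg" and k :: nat and x :: "'a \<Rightarrow> mel"
  assumes A: "is_alg n A" and hom: "alg_hom n A (Malg k) x"
begin

lemma in_Mset: "a \<in> acarrier A \<Longrightarrow> x a \<in> Mset k"
  using hom by (auto simp: alg_hom_def Malg_def)

lemma ops:
  assumes "a \<in> acarrier A" "b \<in> acarrier A"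
  shows "x (akmeet A a b) = kmeet (x a) (x b)" "x (akjoin A a b) = kjoin (x a) (x b)"
    "x (atmeet A a b) = tmeet (x a) (x b)" "x (atjoin A a b) = tjoin (x a) (x b)"
  using hom Malg_ops[OF in_Mset[OF assms(1)] in_Mset[OF assms(2)]] assms by (auto simp: alg_hom_def)

lemma neg: "a \<in> acarrier A \<Longrightarrow> x (aneg A a) = mneg (x a)"
  using hom by (auto simp: alg_hom_def Malg_def)

lemma constants: "x (atop A) = Top" "x (abot A) = Bot"
  "i \<le> n \<Longrightarrow> x (afc A i) = (if i < k then Zv else Fv)"
  "i \<le> n \<Longrightarrow> x (atc A i) = (if i < k then Ov else Tv)"
  using hom by (auto simp: alg_hom_def Malg_def)

end

lemma alg_hom_MalgI:
  assumes "\<And>a. a \<in> acarrier A \<Longrightarrow> x a \<in> Mset k"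
    and "\<And>a b. \<lbrakk>a \<in> acarrier A; b \<in> acarrier A\<rbrakk> \<Longrightarrow>
      x (akmeet A a b) = kmeet (x a) (x b) \<and> x (akjoin A a b) = kjoin (x a) (x b) \<and>
      x (atmeet A a b) = tmeet (x a) (x b) \<and> x (atjoin A a b) = tjoin (x a) (x b)"
    and "\<And>a. a \<in> acarrier A \<Longrightarrow> x (aneg A a) = mneg (x a)"
    and "x (atop A) = Top" "x (abot A) = Bot"
    and "\<And>i. i \<le> n \<Longrightarrow> x (afc A i) = (if i < k then Zv else Fv) \<and> x (atc A i) = (if i < k then Ov else Tv)"
  shows "alg_hom n A (Malg k) x"
proof -
  have "\<forall>a\<in>acarrier A. \<forall>b\<in>acarrier A.
      x (akmeet A a b) = akmeet (Malg k) (x a) (x b) \<and> x (akjoin A a b) = akjoin (Malg k) (x a) (x b) \<and>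
      x (atmeet A a b) = atmeet (Malg k) (x a) (x b) \<and> x (atjoin A a b) = atjoin (Malg k) (x a) (x b)"
    using assms(1,2) Malg_ops by simp
  then show ?thesis
    unfolding alg_hom_def using assms(1,3-6) by (auto simp: Malg_def)
qed

lemma gM_ops:
  "gM (kmeet a b) = kmeet (gM a) (gM b)" "gM (kjoin a b) = kjoin (gM a) (gM b)"
  "gM (tmeet a b) = tmeet (gM a) (gM b)" "gM (tjoin a b) = tjoin (gM a) (gM b)"
  "gM (mneg a) = mneg (gM a)"
  by (cases a; cases b; simp add: mel_ops)+

lemma (in Mhom) gM_hom: "alg_hom n A (Malg 0) (\<lambda>a\<in>acarrier A. gM (x a))"
  by (rule alg_hom_MalgI)
    (simp_all add: gM_in_Mset_0 is_alg_closed[OF A] is_alg_consts[OF A] ops neg constants gM_ops)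

section \<open>The dual structure of an algebra is a closed substructure of a power\<close>

lemma closedin_locally_constant_Ball:
  assumes "\<And>i. i \<in> I \<Longrightarrow> locally_constant T (P i)"
  shows "closedin T {x \<in> topspace T. \<forall>i\<in>I. P i x}"
proof (cases "I = {}")
  case False
  then have "{x \<in> topspace T. \<forall>i\<in>I. P i x} = (\<Inter>i\<in>I. {x \<in> topspace T. P i x})"
    by auto
  then show ?thesis
    using False assms by (auto intro!: closedin_INT locally_constant_clopen(2))
qed auto

text \<open>Each condition involves finitely many coordinates and, for the constants, the sort, so
  it is clopen and their intersection is closed. The conditions on \<open>atop\<close> and
  \<open>abot\<close> can sit under the quantifier over \<open>i\<close> because
  \<open>{..n}\<close> contains 0.\<close>

lemma Dhoms_eq:
  assumes "is_alg n A"
  shows "Dhoms n A =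
    {p \<in> topspace (mtop (powstruct n (acarrier A))). \<forall>(a, b)\<in>acarrier A \<times> acarrier A.
       snd p (akmeet A a b) = kmeet (snd p a) (snd p b) \<and> snd p (akjoin A a b) = kjoin (snd p a) (snd p b) \<and>
       snd p (atmeet A a b) = tmeet (snd p a) (snd p b) \<and> snd p (atjoin A a b) = tjoin (snd p a) (snd p b)} \<inter>
    {p \<in> topspace (mtop (powstruct n (acarrier A))). \<forall>a\<in>acarrier A. snd p (aneg A a) = mneg (snd p a)} \<inter>
    {p \<in> topspace (mtop (powstruct n (acarrier A))). \<forall>i\<in>{..n}. 
       snd p (atop A) = Top \<and> snd p (abot A) = Bot \<and>
       snd p (afc A i) = (if i < fst p then Zv else Fv) \<and> snd p (atc A i) = (if i < fst p then Ov else Tv)}"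
  (is "_ = ?R")
proof (intro equalityI subsetI)
  fix p assume "p \<in> Dhoms n A"
  then obtain k x where p: "p = (k, x)" "k \<le> n" "x \<in> extensional (acarrier A)" "alg_hom n A (Malg k) x"
    by (auto simp: Dhoms_def)
  interpret Mhom n A k x
    using assms p(4) by unfold_locales
  show "p \<in> ?R"
    using p(2,3) in_Mset by (auto simp: p(1) powstruct_def ops neg constants PiE_def)
next
  fix p assume R: "p \<in> ?R"
  obtain k x where p: "p = (k, x)" by (cases p)
  have x: "k \<le> n" "x \<in> (\<Pi>\<^sub>E s\<in>acarrier A. Mset k)"
    using R by (auto simp: p powstruct_def)
  have "alg_hom n A (Malg k) x"
    by (rule alg_hom_MalgI) (use R x in \<open>auto simp: p\<close>)
  then show "p \<in> Dhoms n A"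
    using x by (auto simp: p Dhoms_def PiE_def)
qed

lemma closed_substruct_Dhoms:
  assumes A: "is_alg n A"
  shows "closed_substruct n (powstruct n (acarrier A)) (Dhoms n A)"
proof -
  let ?T = "mtop (powstruct n (acarrier A))"
  note ev = locally_constant_powstruct_eval[where n = n and S = "acarrier A"]
  have op: "locally_constant ?T (\<lambda>p. snd p c = F (snd p a) (snd p b))"
    if "a \<in> acarrier A" "b \<in> acarrier A" "c \<in> acarrier A" for a b c and F :: "mel \<Rightarrow> mel \<Rightarrow> mel"
    by (rule locally_constant_comp3[OF ev ev ev, of _ _ _ "\<lambda>u v w. u = F v w"]) (use that in auto)
  have const: "locally_constant ?T (\<lambda>p. snd p c = F (fst p))" if "c \<in> acarrier A" for c and F :: "nat \<Rightarrow> mel"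
    by (rule locally_constant_comp2[OF ev locally_constant_powstruct_fst, of _ "\<lambda>u v. u = F v"]) (use that in auto)
  note conj = locally_constant_comp2[where H = "(\<and>)"]
  have "closedin ?T (Dhoms n A)"
    unfolding Dhoms_eq[OF A]
  proof (intro closedin_Int closedin_locally_constant_Ball)
    fix ab assume "ab \<in> acarrier A \<times> acarrier A"
    then obtain a b where ab: "ab = (a, b)" "a \<in> acarrier A" "b \<in> acarrier A" by auto
    show "locally_constant ?T (\<lambda>p. case ab of (a, b) \<Rightarrow>
       snd p (akmeet A a b) = kmeet (snd p a) (snd p b) \<and> snd p (akjoin A a b) = kjoin (snd p a) (snd p b) \<and>
       snd p (atmeet A a b) = tmeet (snd p a) (snd p b) \<and> snd p (atjoin A a b) = tjoin (snd p a) (snd p b))"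
      unfolding ab(1) prod.case
      by (intro conj op ab(2,3) is_alg_closed[OF A])
  next
    fix a assume a: "a \<in> acarrier A"
    show "locally_constant ?T (\<lambda>p. snd p (aneg A a) = mneg (snd p a))"
      by (rule op[OF a a, of _ "\<lambda>u v. mneg u"]) (rule is_alg_closed[OF A a a])
  next
    fix i assume i: "i \<in> {..n}"
    then show "locally_constant ?T (\<lambda>p. snd p (atop A) = Top \<and> snd p (abot A) = Bot \<and>
       snd p (afc A i) = (if i < fst p then Zv else Fv) \<and> snd p (atc A i) = (if i < fst p then Ov else Tv))"
      by (intro conj const is_alg_consts[OF A]) auto
  qed
  moreover have "gmap (powstruct n (acarrier A)) k y \<in> Dhoms n A" if Dy: "y \<in> Dhoms n A" for k y
  proof -
    obtain l x where y: "y = (l, x)" "alg_hom n A (Malg l) x"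
      using Dy by (auto simp: Dhoms_def)
    interpret Mhom n A l x
      using A y(2) by unfold_locales
    show ?thesis
      using gM_hom by (auto simp: powstruct_def Dhoms_def y(1))
  qed
  ultimately show ?thesis
    unfolding closed_substruct_def using closedin_subset by blast
qed

lemma topspace_Dfun:
  assumes "is_alg n A"
  shows "topspace (mtop (Dfun n A)) = Dhoms n A"
  using closed_substruct_Dhoms[OF assms] by (auto simp: Dfun_def substruct_def closed_substruct_def)

subsection \<open>The Priestley dual of the lattice reduct\<close>

text \<open>The prime filters of the truth lattice of \<open>M_0\<close> are \<open>{Tv, Top}\<close> and \<open>{Tv, Bot}\<close>; those of
  \<open>M_k\<close>, \<open>k > 0\<close>, that do not come from \<open>M_0\<close> via \<open>gM\<close> are \<open>{Ov}\<close> and the complement of \<open>{Zv}\<close>.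
  The flag marks the one attached to a hatted point.\<close>

definition val :: "bool \<Rightarrow> nat \<Rightarrow> mel \<Rightarrow> bool" where
  "val b k v \<longleftrightarrow> (if k = 0 then v = Tv \<or> v = (if b then Bot else Top) else if b then v \<noteq> Zv else v = Ov)"

definition Psi :: "'a alg \<Rightarrow> bool \<times> nat \<times> ('a \<Rightarrow> mel) \<Rightarrow> 'a \<Rightarrow> bool" where
  "Psi A p = (\<lambda>a\<in>acarrier A. val (fst p) (fst (snd p)) (snd (snd p) a))"

lemma val_lattice:
  assumes "u \<in> Mset k" "v \<in> Mset k"
  shows "val b k (tmeet u v) \<longleftrightarrow> val b k u \<and> val b k v" "val b k (tjoin u v) \<longleftrightarrow> val b k u \<or> val b k v"
  using assms by (cases "k = 0"; cases u; cases v; simp add: mel_ops val_def Mset_def)+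

lemma val_neg: "u \<in> Mset k \<Longrightarrow> val b k (mneg u) \<longleftrightarrow> \<not> val (\<not> b) k u"
  by (cases "k = 0"; cases u; cases b) (simp_all add: val_def Mset_def)

text \<open>Together, the filters of \<open>M_k\<close> itself and those pulled back along
  \<open>gM\<close> are all its prime filters, so they detect every failure of the truth
  order.\<close>

lemma val_separation:
  assumes "u \<in> Mset k" "v \<in> Mset k" "tmeet u v \<noteq> u"
  shows "(\<exists>b. val b k u \<and> \<not> val b k v) \<or> (\<exists>b. val b 0 (gM u) \<and> \<not> val b 0 (gM v))"
  using assms by (cases "k = 0"; cases u; cases v) (auto simp: mel_ops val_def Mset_def)

text \<open>For the knowledge order of \<open>M_0\<close>, \<open>{Tv, Top}\<close> is an up-set and
  \<open>{Tv, Bot}\<close> a down-set; for \<open>relM 1 1\<close>, so are \<open>{Ov}\<close> and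
  the complement of \<open>{Zv}\<close>, respectively. Between sorts, \<open>gM Ov = Tv\<close> lies
  in both filters of \<open>M_0\<close>, and \<open>gM Zv = Fv\<close> in neither.\<close>

lemma val_mono:
  assumes "pow_le S (b, j, x) (c, k, y)" "a \<in> S" "x a \<in> Mset j" "y a \<in> Mset k" "val b j (x a)"
  shows "val c k (y a)"
proof -
  note [simp] = val_def relM_def kle_def Mset_def
  note D = gleD[OF _ assms(2)] rleD[OF _ assms(2)]
  consider (FF) "\<not> b" "\<not> c" | (TT) "b" "c" | (FT) "\<not> b" "c"
    using assms(1) by (cases b; cases c) auto
  then show ?thesis
  proof cases
    case FF
    then consider "k = 0" "kle (gM (x a)) (gM (y a))" | "1 \<le> j" "j \<le> k" "relM (Suc 0) (Suc 0) (x a) (y a)"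
      using assms(1) D by auto
    then show ?thesis
      using assms(3-5) FF by cases (cases "j = 0"; cases "x a"; cases "y a"; simp)+
  next
    case TT
    then consider "j = 0" "kle (gM (y a)) (gM (x a))" | "1 \<le> k" "k \<le> j" "relM (Suc 0) (Suc 0) (y a) (x a)"
      using assms(1) D by auto
    then show ?thesis
      using assms(3-5) TT by cases (cases "k = 0"; cases "x a"; cases "y a"; simp)+
  next
    case FT
    then consider "1 \<le> j" "kle (gM (y a)) (gM (x a))" | "1 \<le> k" "kle (gM (x a)) (gM (y a))"
      using assms(1) D by auto
    then show ?thesis
      using assms(3-5) FT by cases (cases "j = 0"; cases "k = 0"; cases "x a"; cases "y a"; simp)+
  qed
qed

section \<open>Order reflection by terms of the algebra\<close>

locale Mhom_pair = X: Mhom n A j x + Y: Mhom n A k y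
  for n :: nat and A :: "'a alg" and j x k y
begin

lemmas alg_closed = is_alg_closed[OF X.A] is_alg_consts[OF X.A]
lemmas hom_simps = X.ops Y.ops X.neg Y.neg X.constants Y.constants alg_closed

text \<open>The hypothesis concerns one filter per sort. Applied to unary terms in \<open>a\<close>,
  under which that filter pulls back to other subsets, it compares \<open>x a\<close> with
  \<open>y a\<close> completely.\<close>

lemma val_reflect_unhatted:
  assumes le: "\<And>a. a \<in> acarrier A \<Longrightarrow> val False j (x a) \<Longrightarrow> val False k (y a)" and "j \<le> n"
  shows "pow_le (acarrier A) (False, j, x) (False, k, y)"
proof -
  let ?C = "acarrier A"
  \<comment> \<open>On \<open>M_i\<close> with \<open>i > 0\<close>, \<open>?up\<close> sends exactly \<open>Tv, Ov, Top\<close> to \<open>Ov\<close>, and \<open>?dn\<close> sends exactly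
    \<open>Tv, Ov, Bot\<close> to \<open>Ov\<close>.\<close>
  let ?up = "\<lambda>a. akmeet A (atmeet A a (atop A)) (atc A 0)"
  let ?dn = "\<lambda>a. akjoin A a (atc A 0)"
  have le': "val False j (x a) \<longrightarrow> val False k (y a)" if "a \<in> ?C" for a
    using le that by blast
  note [simp] = val_def mel_ops Mset_def
  show ?thesis
  proof (cases "k = 0")
    case k: True
    have "kle (gM (x a)) (gM (y a))" if a: "a \<in> ?C" for a
    proof (cases "j = 0")
      case True
      \<comment> \<open>Membership of \<open>a\<close> and of its negation in
        \<open>{Tv, Top}\<close> determines a value in \<open>M_0\<close>, and the knowledge order
        is the componentwise order of these two bits.\<close>
      show ?thesis
        using le'[OF a] le'[of "aneg A a"] a X.in_Mset[OF a] Y.in_Mset[OF a] True k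
        by (cases "x a"; cases "y a") (simp_all add: hom_simps)
    next
      case False
      show ?thesis
        using le'[of "?up a"] le'[of "?up (aneg A a)"] a X.in_Mset[OF a] Y.in_Mset[OF a] False k
        by (cases "x a"; cases "y a") (simp_all add: hom_simps)
    qed
    then show ?thesis using k by (simp add: gle_def)
  next
    case k: False
    \<comment> \<open>The constant \<open>atop\<close> lies in the unhatted filter of
      \<open>M_0\<close> but not in \<open>{Ov}\<close>.\<close>
    have j: "j \<noteq> 0"
      using le'[of "atop A"] k by (cases "j = 0") (simp_all add: hom_simps)
    \<comment> \<open>The constant with index \<open>j - 1\<close> is the last one with value
      \<open>Ov\<close> in \<open>M_j\<close>; that it is \<open>Ov\<close> in \<open>M_k\<close>
      too means \<open>j - 1 < k\<close>.\<close>
    have "j - 1 \<le> n" using \<open>j \<le> n\<close> by simp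
    then have "j \<le> k"
      using le'[of "atc A (j - 1)"] k j by (auto simp: hom_simps split: if_splits)
    \<comment> \<open>The instances with \<open>?up\<close> and \<open>?dn\<close> force equal
      values under \<open>gM\<close>; those with \<open>a\<close> and its negation say that
      \<open>Ov\<close> and \<open>Zv\<close> are preserved.\<close>
    moreover have "relM 1 1 (x a) (y a)" if a: "a \<in> ?C" for a
      using le'[OF a] le'[of "aneg A a"] le'[of "?up a"] le'[of "?up (aneg A a)"]
        le'[of "?dn a"] le'[of "?dn (aneg A a)"] a j k
      by (cases "x a"; cases "y a") (simp_all add: hom_simps relM_def)
    ultimately show ?thesis using j by (simp add: rle_def)
  qed
qed

text \<open>The remaining combination, \<open>j = 0\<close> with \<open>k > 0\<close>, is dual under
  negation to the case \<open>k = 0\<close> treated here.\<close>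

lemma val_reflect_mixed:
  assumes le: "\<And>a. a \<in> acarrier A \<Longrightarrow> val False j (x a) \<Longrightarrow> val True k (y a)" and "k = 0 \<or> j \<noteq> 0"
  shows "pow_le (acarrier A) (False, j, x) (True, k, y)"
proof -
  let ?C = "acarrier A"
  let ?up = "\<lambda>a. akmeet A (atmeet A a (atop A)) (atc A 0)"
  let ?dn = "\<lambda>a. akjoin A a (atc A 0)"
  have le': "val False j (x a) \<longrightarrow> val True k (y a)" if "a \<in> ?C" for a
    using le that by blast
  note [simp] = val_def mel_ops Mset_def
  show ?thesis
  proof (cases "k = 0")
    case k: True
    then have j: "j \<noteq> 0"
      using le'[of "atop A"] by (cases "j = 0") (simp_all add: hom_simps)
    have "kle (gM (y a)) (gM (x a))" if a: "a \<in> ?C" for a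
      using le'[of "?dn a"] le'[of "?dn (aneg A a)"] a Y.in_Mset[OF a] j k
      by (cases "x a"; cases "y a") (simp_all add: hom_simps)
    then show ?thesis using j by (simp add: gle_def)
  next
    case k: False
    then have j: "j \<noteq> 0" using assms(2) by simp
    have "gle ?C x y \<or> gle ?C y x"
    proof (rule ccontr)
      assume "\<not> ?thesis"
      then obtain a b where a: "a \<in> ?C" "\<not> kle (gM (x a)) (gM (y a))"
        and b: "b \<in> ?C" "\<not> kle (gM (y b)) (gM (x b))"
        by (auto simp: gle_def)
      \<comment> \<open>The value \<open>gM (x a)\<close> carries information, for or against, that
        \<open>gM (y a)\<close> lacks. \<open>?up\<close> keeps information for and its negated
        version information against, so one of them gives \<open>Ov\<close> at \<open>x\<close> and
        \<open>Bot\<close> at \<open>y\<close>.\<close>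
      have "\<exists>a'\<in>?C. x a' = Ov \<and> y a' = Bot"
      proof (cases "x (?up a) = Ov \<and> y (?up a) = Bot")
        case True
        with a(1) show ?thesis by (intro bexI[of _ "?up a"]) (auto simp: alg_closed)
      next
        case False
        then have "x (?up (aneg A a)) = Ov \<and> y (?up (aneg A a)) = Bot"
          using a j k by (cases "x a"; cases "y a") (simp_all add: hom_simps)
        with a(1) show ?thesis by (intro bexI[of _ "?up (aneg A a)"]) (auto simp: alg_closed)
      qed
      then obtain a' where a': "a' \<in> ?C" "x a' = Ov" "y a' = Bot" by blast
      \<comment> \<open>Now \<open>y\<close> carries the extra information, and \<open>?dn\<close>
        turns it into \<open>Top\<close> at \<open>y\<close> while leaving \<open>Ov\<close> at
        \<open>x\<close>.\<close>
      have "\<exists>b'\<in>?C. x b' = Ov \<and> y b' = Top"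
      proof (cases "x (?dn b) = Ov \<and> y (?dn b) = Top")
        case True
        with b(1) show ?thesis by (intro bexI[of _ "?dn b"]) (auto simp: alg_closed)
      next
        case False
        then have "x (?dn (aneg A b)) = Ov \<and> y (?dn (aneg A b)) = Top"
          using b j k by (cases "x b"; cases "y b") (simp_all add: hom_simps)
        with b(1) show ?thesis by (intro bexI[of _ "?dn (aneg A b)"]) (auto simp: alg_closed)
      qed
      then obtain b' where b': "b' \<in> ?C" "x b' = Ov" "y b' = Top" by blast
      \<comment> \<open>Joining with \<open>Zv\<close> raises \<open>Ov\<close> to
        \<open>Top\<close> at \<open>x\<close> and \<open>Bot\<close> to \<open>Zv\<close> at
        \<open>y\<close>; meeting with \<open>b'\<close> brings \<open>x\<close> back to
        \<open>Ov\<close> and keeps \<open>Zv\<close> at \<open>y\<close>. This contradicts the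
        inclusion of \<open>{Ov}\<close> in the complement of \<open>{Zv}\<close>.\<close>
      let ?c = "akmeet A (akjoin A a' (afc A 0)) b'"
      have "x ?c = Ov" "y ?c = Zv"
        using a' b' j k by (simp_all add: hom_simps)
      moreover have "?c \<in> ?C"
        using a' b' by (simp add: alg_closed)
      ultimately show False
        using le'[of ?c] j k by simp
    qed
    then show ?thesis using j k by auto
  qed
qed

end

lemma val_reflect:
  assumes A: "is_alg n A" and x: "alg_hom n A (Malg j) x" and y: "alg_hom n A (Malg k) y" and "j \<le> n" "k \<le> n"
    and le: "\<And>a. a \<in> acarrier A \<Longrightarrow> val b j (x a) \<Longrightarrow> val c k (y a)"
  shows "pow_le (acarrier A) (b, j, x) (c, k, y)"
proof -
  interpret XY: Mhom_pair n A j x k y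
    using A x y by unfold_locales
  interpret YX: Mhom_pair n A k y j x ..
  text \<open>Composition with negation exchanges the two flags and reverses the order.\<close>
  have dual: "val (\<not> b) j (x a)" if "a \<in> acarrier A" "val (\<not> c) k (y a)" for a
    using le[of "aneg A a"] that XY.X.in_Mset[of a] XY.Y.in_Mset[of a] by (auto simp: XY.hom_simps val_neg)
  consider (FF) "\<not> b" "\<not> c" | (TT) "b" "c" | (FT) "\<not> b" "c" | (TF) "b" "\<not> c"
    by blast
  then show ?thesis
  proof cases
    case FF
    then show ?thesis using XY.val_reflect_unhatted le \<open>j \<le> n\<close> by simp
  next
    case TT
    then show ?thesis
      using YX.val_reflect_unhatted dual \<open>k \<le> n\<close> pow_le_flip[of "acarrier A" False "(k, y)" False "(j, x)"] by simp
  next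
    case FT
    show ?thesis
    proof (cases "k = 0 \<or> j \<noteq> 0")
      case True
      then show ?thesis using XY.val_reflect_mixed le FT by simp
    next
      case False
      then have "pow_le (acarrier A) (False, k, y) (True, j, x)"
        using YX.val_reflect_mixed dual FT by simp
      then show ?thesis
        using pow_le_flip[of "acarrier A" True "(j, x)" False "(k, y)"] FT by simp
    qed
  next
    case TF
    \<comment> \<open>The constant \<open>abot\<close> lies in every hatted filter and in no
      unhatted one, so this case cannot occur.\<close>
    then show ?thesis
      using le[of "abot A"] by (cases "j = 0"; cases "k = 0") (simp_all add: XY.hom_simps val_def)
  qed
qed


section \<open>The homeomorphism between the dual of the lattice reduct and the doubled
  space\<close>

lemma Dhoms_iff: "(k, x) \<in> Dhoms n A \<longleftrightarrow> k \<le> n \<and> x \<in> extensional (acarrier A) \<and> alg_hom n A (Malg k) x"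
  by (simp add: Dhoms_def)

lemma topspace_Htop: "topspace (Htop A) = Hset A"
  by (auto simp: Htop_def Hset_def PiE_def)

lemma Psi_in_Hset:
  assumes A: "is_alg n A" and p: "p \<in> UNIV \<times> Dhoms n A"
  shows "Psi A p \<in> Hset A"
proof -
  obtain b k x where bkx: "p = (b, k, x)" by (metis prod.exhaust)
  then interpret Mhom n A k x
    using A p by unfold_locales (auto simp: Dhoms_iff)
  have "val b k (x (afc A 0)) = False" "val b k (x (atc A 0)) = True"
    by (cases "k = 0"; simp add: constants val_def)+
  then show ?thesis
    by (simp add: Hset_def Psi_def bkx is_alg_closed[OF A] is_alg_consts[OF A] ops val_lattice in_Mset)
qed

lemma continuous_map_Psi:
  assumes A: "is_alg n A"
  shows "continuous_map (Ptop (Dfun n A)) (Htop A) (Psi A)"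
  unfolding Htop_def
proof (rule continuous_map_into_subtopology)
  have "continuous_map (Ptop (Dfun n A)) (discrete_topology UNIV) (\<lambda>p. Psi A p a)" if a: "a \<in> acarrier A" for a
    using locally_constant_Ptop_pow[OF a a, of n "Dhoms n A" "\<lambda>b k u v. val b k u"] a
    by (simp add: Psi_def Dfun_def locally_constant_def)
  then show "continuous_map (Ptop (Dfun n A)) (product_topology (\<lambda>a. discrete_topology UNIV) (acarrier A)) (Psi A)"
    by (auto simp: continuous_map_componentwise Psi_def)
  show "Psi A \<in> topspace (Ptop (Dfun n A)) \<rightarrow> Hset A"
    using Psi_in_Hset[OF A] by (simp add: topspace_Dfun[OF A])
qed

lemma Hle_Psi_iff:
  assumes A: "is_alg n A" and p: "p \<in> topspace (Ptop (Dfun n A))" and q: "q \<in> topspace (Ptop (Dfun n A))"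
  shows "Hle A (Psi A p) (Psi A q) \<longleftrightarrow> Ple n (Dfun n A) p q"
proof -
  obtain b j x c k y where pq: "p = (b, j, x)" "q = (c, k, y)" by (metis prod.exhaust)
  have xy: "j \<le> n" "k \<le> n" "alg_hom n A (Malg j) x" "alg_hom n A (Malg k) y"
    using p q by (auto simp: topspace_Dfun[OF A] pq Dhoms_iff)
  interpret X: Mhom n A j x using A xy(3) by unfold_locales
  interpret Y: Mhom n A k y using A xy(4) by unfold_locales
  have "Ple n (Dfun n A) p q \<longleftrightarrow> pow_le (acarrier A) p q"
    using Ple_substruct_powstruct[OF closed_substruct_Dhoms[OF A]] p q unfolding Dfun_def by blast
  also have "\<dots> \<longleftrightarrow> (\<forall>a\<in>acarrier A. val b j (x a) \<longrightarrow> val c k (y a))"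
  proof
    assume "pow_le (acarrier A) p q"
    then show "\<forall>a\<in>acarrier A. val b j (x a) \<longrightarrow> val c k (y a)"
      using val_mono X.in_Mset Y.in_Mset unfolding pq by meson
  next
    assume "\<forall>a\<in>acarrier A. val b j (x a) \<longrightarrow> val c k (y a)"
    then show "pow_le (acarrier A) p q"
      unfolding pq by (intro val_reflect[OF A xy(3,4,1,2)]) blast
  qed
  finally show ?thesis
    by (auto simp: Hle_def Psi_def pq)
qed

text \<open>If b is not below c, this shows in some coordinate of the embedding, and that coordinate
  is a homomorphism into some \<open>M_k\<close>. A filter of \<open>M_k\<close> itself gives a
  point over it, a pulled-back filter a point over its composite with \<open>gM\<close>.\<close>

lemma Psi_separation:
  assumes V: "in_Vn n TYPE('i) A" and bc: "b \<in> acarrier A" "c \<in> acarrier A" "atmeet A b c \<noteq> b"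
  shows "\<exists>p\<in>UNIV \<times> Dhoms n A. Psi A p b \<and> \<not> Psi A p c"
proof -
  let ?C = "acarrier A"
  have A: "is_alg n A" using V by (simp add: in_Vn_def)
  obtain I :: "'i set" and \<kappa> h where I: "\<And>i. i \<in> I \<Longrightarrow> \<kappa> i \<le> n" and h: "alg_hom n A (prodalg I \<kappa>) h"
    and inj: "inj_on h ?C"
    using V unfolding in_Vn_def by blast
  have hC: "h a \<in> (\<Pi>\<^sub>E i\<in>I. Mset (\<kappa> i))" if "a \<in> ?C" for a
    using h that by (auto simp: alg_hom_def prodalg_def)
  have "h (atmeet A b c) \<noteq> h b"
    using inj bc is_alg_closed[OF A] by (metis inj_on_eq_iff)
  then obtain i where i: "i \<in> I" "h (atmeet A b c) i \<noteq> h b i"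
    using PiE_ext[OF hC hC] bc is_alg_closed[OF A] by metis
  define x where "x = (\<lambda>a\<in>?C. h a i)"
  have "alg_hom n A (Malg (\<kappa> i)) x"
  proof (rule alg_hom_MalgI)
    show "x a \<in> Mset (\<kappa> i)" if "a \<in> ?C" for a
      using hC[OF that] i(1) that by (auto simp: x_def)
  next
    fix a b assume ab: "a \<in> ?C" "b \<in> ?C"
    then have "h a i \<in> Mset (\<kappa> i)" "h b i \<in> Mset (\<kappa> i)"
      using hC i(1) by (auto simp: PiE_def Pi_def)
    then show "x (akmeet A a b) = kmeet (x a) (x b) \<and> x (akjoin A a b) = kjoin (x a) (x b) \<and>
      x (atmeet A a b) = tmeet (x a) (x b) \<and> x (atjoin A a b) = tjoin (x a) (x b)"
      using h ab i(1) is_alg_closed[OF A ab] by (simp add: x_def alg_hom_def prodalg_def Malg_ops)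
  qed (use h i(1) is_alg_closed[OF A] is_alg_consts[OF A] in
        \<open>simp_all add: x_def alg_hom_def prodalg_def Malg_def\<close>)
  then interpret Mhom n A "\<kappa> i" x
    using A by unfold_locales
  have "tmeet (x b) (x c) \<noteq> x b"
    using i(2) ops(3)[OF bc(1,2)] bc is_alg_closed[OF A] by (simp add: x_def)
  then consider d where "val d (\<kappa> i) (x b)" "\<not> val d (\<kappa> i) (x c)"
    | d where "val d 0 (gM (x b))" "\<not> val d 0 (gM (x c))"
    using val_separation[OF in_Mset[OF bc(1)] in_Mset[OF bc(2)]] by blast
  then show ?thesis
  proof cases
    case 1
    have "(d, \<kappa> i, x) \<in> UNIV \<times> Dhoms n A"
      using I[OF i(1)] hom by (simp add: Dhoms_iff x_def)
    then show ?thesis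
      by (rule rev_bexI) (simp add: Psi_def bc 1)
  next
    case 2
    have "(d, 0, \<lambda>a\<in>?C. gM (x a)) \<in> UNIV \<times> Dhoms n A"
      using gM_hom by (simp add: Dhoms_iff)
    then show ?thesis
      by (rule rev_bexI) (simp add: Psi_def bc 2)
  qed
qed

text \<open>Finitely many conditions on a point of \<open>Hset A\<close> are forced by one; the
  empty meet is the top constant with index 0. With the dual statement for joins, a basic
  neighbourhood contains one determined by a pair of elements.\<close>

lemma Hset_finite_meet:
  assumes A: "is_alg n A" and "h \<in> Hset A" "finite B" "B \<subseteq> acarrier A" "\<forall>a\<in>B. h a"
  shows "\<exists>b\<in>acarrier A. h b \<and> (\<forall>h'\<in>Hset A. h' b \<longrightarrow> (\<forall>a\<in>B. h' a))"
  using assms(3-5)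
proof (induction B rule: finite_induct)
  case empty
  then show ?case
    using assms(2) is_alg_consts(4)[OF A, of 0] by (auto simp: Hset_def)
next
  case (insert a B)
  then obtain b where b: "b \<in> acarrier A" "h b" "\<forall>h'\<in>Hset A. h' b \<longrightarrow> (\<forall>a\<in>B. h' a)"
    by auto
  then have "\<forall>h'\<in>Hset A. h' (atmeet A a b) \<longleftrightarrow> h' a \<and> h' b"
    using insert.prems by (auto simp: Hset_def)
  then show ?case
    using b insert.prems assms(2) is_alg_closed(3)[OF A, of a b] by (intro bexI[of _ "atmeet A a b"]) auto
qed

lemma Hset_finite_join:
  assumes A: "is_alg n A" and "h \<in> Hset A" "finite B" "B \<subseteq> acarrier A" "\<forall>a\<in>B. \<not> h a"
  shows "\<exists>b\<in>acarrier A. \<not> h b \<and> (\<forall>h'\<in>Hset A. \<not> h' b \<longrightarrow> (\<forall>a\<in>B. \<not> h' a))"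
  using assms(3-5)
proof (induction B rule: finite_induct)
  case empty
  then show ?case
    using assms(2) is_alg_consts(3)[OF A, of 0] by (auto simp: Hset_def)
next
  case (insert a B)
  then obtain b where b: "b \<in> acarrier A" "\<not> h b" "\<forall>h'\<in>Hset A. \<not> h' b \<longrightarrow> (\<forall>a\<in>B. \<not> h' a)"
    by auto
  then have "\<forall>h'\<in>Hset A. h' (atjoin A a b) \<longleftrightarrow> h' a \<or> h' b"
    using insert.prems by (auto simp: Hset_def)
  then show ?case
    using b insert.prems assms(2) is_alg_closed(4)[OF A, of a b] by (intro bexI[of _ "atjoin A a b"]) auto
qed

lemma Psi_onto:
  assumes V: "in_Vn n TYPE('i) A" and h: "h \<in> Hset A"
  shows "h \<in> Psi A ` topspace (Ptop (Dfun n A))"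
proof (rule ccontr)
  assume notin: "h \<notin> Psi A ` topspace (Ptop (Dfun n A))"
  let ?C = "acarrier A" and ?T = "Ptop (Dfun n A)"
  have A: "is_alg n A" using V by (simp add: in_Vn_def)
  have T: "topspace ?T = UNIV \<times> Dhoms n A"
    by (simp add: topspace_Dfun[OF A])
  \<comment> \<open>\<open>U a\<close> collects the points whose image differs from \<open>h\<close>
    at \<open>a\<close>. As \<open>h\<close> is not in the image these open sets cover the space,
    and a point whose image agrees with \<open>h\<close> on the indices of a finite subcover is a
    contradiction.\<close>
  define U where "U a = {p \<in> topspace ?T. Psi A p a \<noteq> h a}" for a
  have "openin ?T (U a)" if a: "a \<in> ?C" for a
    using locally_constant_clopen(1)[OF locally_constant_Ptop_pow[OF a a, of n "Dhoms n A" "\<lambda>b k u v. val b k u \<noteq> h a"]] a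
    by (simp add: U_def Psi_def Dfun_def)
  moreover have "topspace ?T \<subseteq> \<Union> (U ` ?C)"
  proof
    fix p assume p: "p \<in> topspace ?T"
    then have "Psi A p \<noteq> h" using notin by blast
    moreover have "Psi A p \<in> extensional ?C" "h \<in> extensional ?C"
      using h by (auto simp: Psi_def Hset_def)
    ultimately obtain a where "a \<in> ?C" "Psi A p a \<noteq> h a"
      using extensionalityI[of "Psi A p" ?C h] by blast
    then show "p \<in> \<Union> (U ` ?C)" using p by (auto simp: U_def)
  qed
  moreover have "compact_space ?T"
    using compact_space_Ptop_pow[OF closed_substruct_Dhoms[OF A]] by (simp add: Dfun_def)
  ultimately have "\<exists>\<F>. finite \<F> \<and> \<F> \<subseteq> U ` ?C \<and> topspace ?T \<subseteq> \<Union>\<F>"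
    unfolding compact_space_alt by (elim allE[of _ "U ` ?C"]) blast
  then obtain B where B: "finite B" "B \<subseteq> ?C" "topspace ?T \<subseteq> \<Union> (U ` B)"
    by (metis finite_subset_image)
  have fin_meet: "\<exists>b\<in>?C. h b \<and> (\<forall>h'\<in>Hset A. h' b \<longrightarrow> (\<forall>a\<in>{a \<in> B. h a}. h' a))"
    by (rule Hset_finite_meet[OF A h]) (use B(1,2) in auto)
  have fin_join: "\<exists>c\<in>?C. \<not> h c \<and> (\<forall>h'\<in>Hset A. \<not> h' c \<longrightarrow> (\<forall>a\<in>{a \<in> B. \<not> h a}. \<not> h' a))"
    by (rule Hset_finite_join[OF A h]) (use B(1,2) in auto)
  obtain b where b: "b \<in> ?C" "h b" "\<forall>h'\<in>Hset A. h' b \<longrightarrow> (\<forall>a\<in>{a \<in> B. h a}. h' a)"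
    using fin_meet by blast
  obtain c where c: "c \<in> ?C" "\<not> h c" "\<forall>h'\<in>Hset A. \<not> h' c \<longrightarrow> (\<forall>a\<in>{a \<in> B. \<not> h a}. \<not> h' a)"
    using fin_join by blast
  have "h (atmeet A b c) \<longleftrightarrow> h b \<and> h c"
    using h b(1) c(1) by (simp add: Hset_def)
  then have "atmeet A b c \<noteq> b"
    using b(2) c(2) by auto
  then obtain p where p: "p \<in> UNIV \<times> Dhoms n A" "Psi A p b" "\<not> Psi A p c"
    using Psi_separation[OF V b(1) c(1)] by blast
  have "Psi A p a = h a" if "a \<in> B" for a
    using b(3) c(3) p Psi_in_Hset[OF A p(1)] that by (cases "h a") auto
  then show False
    using B(3) p(1) T unfolding U_def by blast
qed

proposition H_homeomorphic_PD:
  assumes V: "in_Vn n TYPE('i) A"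
  shows "\<exists>\<Phi>. homeomorphic_map (Htop A) (Ptop (Dfun n A)) \<Phi> \<and>
    (\<forall>h\<in>topspace (Htop A). \<forall>h'\<in>topspace (Htop A). Hle A h h' \<longleftrightarrow> Ple n (Dfun n A) (\<Phi> h) (\<Phi> h'))"
proof -
  let ?T = "Ptop (Dfun n A)"
  have A: "is_alg n A" using V by (simp add: in_Vn_def)
  have "acarrier A \<noteq> {}"
    using is_alg_consts[OF A] by blast
  then have "priestley ?T (Ple n (Dfun n A))"
    unfolding Dfun_def by (rule priestley_substruct_powstruct[OF _ closed_substruct_Dhoms[OF A]])
  then have cpt: "compact_space ?T"
    and antisym: "\<And>p q. \<lbrakk>p \<in> topspace ?T; q \<in> topspace ?T; Ple n (Dfun n A) p q; Ple n (Dfun n A) q p\<rbrakk> \<Longrightarrow> p = q"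
    unfolding priestley_def by blast+
  \<comment> \<open>Injectivity follows from order reflection and antisymmetry; a continuous
    bijection from a compact onto a Hausdorff space is then a homeomorphism.\<close>
  have "inj_on (Psi A) (topspace ?T)"
  proof (rule inj_onI)
    fix p q assume pq: "p \<in> topspace ?T" "q \<in> topspace ?T" "Psi A p = Psi A q"
    have "Hle A (Psi A p) (Psi A q)" "Hle A (Psi A q) (Psi A p)"
      by (auto simp: Hle_def pq(3))
    then show "p = q"
      using antisym[OF pq(1,2)] Hle_Psi_iff[OF A pq(1,2)] Hle_Psi_iff[OF A pq(2,1)] by blast
  qed
  moreover have "Psi A ` topspace ?T = topspace (Htop A)"
    using Psi_onto[OF V] Psi_in_Hset[OF A] unfolding topspace_Htop topspace_Ptop topspace_Dfun[OF A] by blast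
  moreover have "Hausdorff_space (Htop A)"
    by (simp add: Htop_def Hausdorff_space_subtopology Hausdorff_space_product_topology)
  ultimately have "homeomorphic_map ?T (Htop A) (Psi A)"
    using continuous_imp_homeomorphic_map[OF continuous_map_Psi[OF A] cpt] by blast
  then obtain \<Phi> where \<Phi>: "homeomorphic_maps ?T (Htop A) (Psi A) \<Phi>"
    unfolding homeomorphic_map_maps by blast
  then have "homeomorphic_map (Htop A) ?T \<Phi>"
    using homeomorphic_map_maps homeomorphic_maps_sym by blast
  moreover have "Hle A h h' \<longleftrightarrow> Ple n (Dfun n A) (\<Phi> h) (\<Phi> h')"
    if "h \<in> topspace (Htop A)" "h' \<in> topspace (Htop A)" for h h'
  proof -
    have "\<Phi> h \<in> topspace ?T" "\<Phi> h' \<in> topspace ?T" "Psi A (\<Phi> h) = h" "Psi A (\<Phi> h') = h'"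
      using \<Phi> that unfolding homeomorphic_maps_def continuous_map_def by blast+
    then show ?thesis
      using Hle_Psi_iff[OF A] by metis
  qed
  ultimately show ?thesis by blast
qed

theorem theorem6p2:
  fixes n :: nat
  assumes "n \<ge> 1"
  shows
    "(\<forall>X :: 'x mstruct. in_Xn n TYPE('s) X \<longrightarrow> priestley (Ptop X) (Ple n X))
   \<and> (\<forall>(X :: 'x mstruct) (Y :: 'y mstruct) \<phi>.
        in_Xn n TYPE('s) X \<and> in_Xn n TYPE('t) Y \<and> morph n X Y \<phi> \<longrightarrow>
          continuous_map (Ptop X) (Ptop Y) (Pmap \<phi>) \<and>
          (\<forall>p\<in>topspace (Ptop X). \<forall>q\<in>topspace (Ptop X).
             Ple n X p q \<longrightarrow> Ple n Y (Pmap \<phi> p) (Pmap \<phi> q)))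
   \<and> (\<forall>X :: 'x mstruct. in_Xn n TYPE('s) X \<longrightarrow>
        morph n X X id \<and> Pmap (id :: 'x \<Rightarrow> 'x) = id)
   \<and> (\<forall>(X :: 'x mstruct) (Y :: 'y mstruct) (Z :: 'z mstruct) \<phi> \<psi>.
        in_Xn n TYPE('s) X \<and> in_Xn n TYPE('t) Y \<and> in_Xn n TYPE('u) Z \<and>
        morph n X Y \<phi> \<and> morph n Y Z \<psi> \<longrightarrow>
          morph n X Z (\<psi> \<circ> \<phi>) \<and> Pmap (\<psi> \<circ> \<phi>) = Pmap \<psi> \<circ> Pmap \<phi>)
   \<and> (\<forall>A :: 'a alg. in_Vn n TYPE('i) A \<longrightarrow>
        (\<exists>\<Phi>. homeomorphic_map (Htop A) (Ptop (Dfun n A)) \<Phi> \<and>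
             (\<forall>h\<in>topspace (Htop A). \<forall>h'\<in>topspace (Htop A).
                Hle A h h' \<longleftrightarrow> Ple n (Dfun n A) (\<Phi> h) (\<Phi> h'))))"
proof (intro conjI allI impI)
  fix X :: "'x mstruct" assume "in_Xn n TYPE('s) X"
  then show "priestley (Ptop X) (Ple n X)" by (rule priestley_P)
next
  fix X :: "'x mstruct" and Y :: "'y mstruct" and \<phi>
  assume *: "in_Xn n TYPE('s) X \<and> in_Xn n TYPE('t) Y \<and> morph n X Y \<phi>"
  then show "continuous_map (Ptop X) (Ptop Y) (Pmap \<phi>)"
    by (simp add: continuous_map_Pmap morph_def)
  have "well_sorted n X" "well_sorted n Y"
    using * in_Xn_well_sorted by blast+
  then show "\<forall>p\<in>topspace (Ptop X). \<forall>q\<in>topspace (Ptop X). Ple n X p q \<longrightarrow> Ple n Y (Pmap \<phi> p) (Pmap \<phi> q)"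
    using * morph_Ple by blast
next
  show "Pmap (id :: 'x \<Rightarrow> 'x) = id"
    by (auto simp: Pmap_def)
next
  fix X :: "'x mstruct" and Y :: "'y mstruct" and Z :: "'z mstruct" and \<phi> \<psi>
  assume "in_Xn n TYPE('s) X \<and> in_Xn n TYPE('t) Y \<and> in_Xn n TYPE('u) Z \<and> morph n X Y \<phi> \<and> morph n Y Z \<psi>"
  then show "morph n X Z (\<psi> \<circ> \<phi>)"
    using morph_comp by blast
  show "Pmap (\<psi> \<circ> \<phi>) = Pmap \<psi> \<circ> Pmap \<phi>"
    by (auto simp: Pmap_def)
next
  fix A :: "'a alg" assume "in_Vn n TYPE('i) A"
  then show "\<exists>\<Phi>. homeomorphic_map (Htop A) (Ptop (Dfun n A)) \<Phi> \<and>
      (\<forall>h\<in>topspace (Htop A). \<forall>h'\<in>topspace (Htop A). Hle A h h' \<longleftrightarrow> Ple n (Dfun n A) (\<Phi> h) (\<Phi> h'))"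
    by (rule H_homeomorphic_PD)
qed (rule morph_id)

end
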